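(* Consider Wyner's symmetric network under Model 2 with only Rx-cooperation and $D$ cooperation rounds, as defined in the context. For $\rho\in(0,1)$ and $\rho_f\in(0,1]$, the fundamental MG region $\mathcal S_2^\star(D,\rho,\rho_f)$ includes all nonnegative pairs $(S^{(U)},S^{(e)})$ satisfying $$S^{(U)}\le\frac{\rho\rho_f}{2},\qquad S^{(e)}+M\cdot S^{(U)}\le\rho(1-\rho_f)-\frac{(1-\rho(1-\rho_f))\,\rho^{D+2}(1-\rho_f)^{D+2}}{1-\rho^{D+2}(1-\rho_f)^{D+2}},$$ where $$\begin{aligned}M={}&\frac{2(1-\rho_f)}{\rho_f}-\frac{2(1-\rho(1-\rho_f))\rho^{D+1}(1-\rho_f)^{D+2}}{\rho_f(1-\rho^{D+2}(1-\rho_f)^{D+2})}\\&+\frac{\rho^3\rho_f(1-\rho_f)^2}{1-\rho^2(1-\rho_f)^2}\left(\frac{2}{1-\rho^2(1-\rho_f)^2}-\frac{\rho^{D}(1-\rho_f)^{D}}{1-\rho^{D+2}(1-\rho_f)^{D+2}}\right)\\&-\frac{(1-\rho_f)\left((1-\rho(1-\rho_f))^2+(1-\rho)^2\right)}{\rho_f(1-\rho(1-\rho_f))}\left(\frac{1}{1-\rho(1-\rho_f)}-\frac{\rho^{D+1}(1-\rho_f)^{D+1}}{1-\rho^{D+2}(1-\rho_f)^{D+2}}\right).\end{aligned}$$ For $\rho\in(0,1)$ and $\rho_f=0$ the same result holds with the left-hand side $S^{(e)}+M\cdot S^{(U)}$ of the second inequality replaced by the single term $S^{(e)}$.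
   Context: Throughout, $D$ is a positive even integer. Wyner's symmetric network: for each $K$ there are $K$ transmitters (Txs) and $K$ receivers (Rxs), indexed by $\mathcal K=\{1,\dots,K\}$. Activity. Each Tx $k$ is active ($A_k=1$) with probability $\rho$, independently over $k$, and $A_k=0$ otherwise. Given that Tx $k$ is active, $B_k=1$ with probability $\rho_f$, independently of everything else, and $B_k=0$ otherwise. Let $\mathcal K_{active}=\{k:A_k=1\}$, $\mathcal K_{URLLC}=\{k:A_k=1,B_k=1\}$. Model 2: each Tx in $\mathcal K_{URLLC}$ has only a URLLC message, and each Tx in $\mathcal K_{eMBB}=\mathcal K_{active}\setminus\mathcal K_{URLLC}$ has only an eMBB message. Write $\mathbf A,\mathbf B$ for the activity tuples; all terminals know $(\mathbf A,\mathbf B)$. Messages. For blocklength $n$, the eMBB message $M_k^{(e)}$ ($k\in\mathcal K_{eMBB}$) is uniform on $\{1,\dots,\lfloor 2^{nR_k^{(e)}}\rfloor\}$, where $R_k^{(e)}$ may depend on $k$ and on $(\mathbf A,\mathbf B)$. The URLLC message $M_k^{(U)}$ ($k\in\mathcal K_{URLLC}$) is uniform on $\{1,\dots,\lfloor 2^{nR^{(U)}}\rfloor\}$, with the same rate $R^{(U)}$ for all $k$, not depending on $(\mathbf A,\mathbf B)$. Messages are independent. Channel. For $t=1,\dots,n$, $Y_{k,t}=h_{k,k}X_{k,t}+\sum_{\tilde k\in\{k-1,k+1\}}h_{\tilde k,k}X_{\tilde k,t}+Z_{k,t}$, where indices outside $\mathcal K$ are ignored, inactive Txs send zero, the $h_{\tilde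 k,k}\ge 0$ are fixed real numbers, and the $Z_{k,t}$ are i.i.d. standard Gaussian, independent of all messages. The neighbours of $k$ are $\mathcal N_k=\{k-1,k+1\}\cap\mathcal K$. Communication with only Rx-cooperation (no Tx-cooperation rounds, $D_{Tx}=0$, and $D_{Rx}=D$). (i) Each active Tx $k$ computes $X_k^n$ as a function of its own message and $(\mathbf A,\mathbf B)$, subject to $\frac1n\sum_{t=1}^n X_{k,t}^2\le P$ almost surely. (ii) Each Rx $k\in\mathcal K_{URLLC}$ decodes $M_k^{(U)}$ from $Y_k^n$ and $(\mathbf A,\mathbf B)$ only. (iii) $D$ Rx-cooperation rounds: in each round every active Rx $k$ sends to each active neighbour in $\mathcal N_k$ over a noise-free link of unlimited capacity an arbitrary function of $Y_k^n$, the cooperation messages it received in previous rounds, and $(\mathbf A,\mathbf B)$. (iv) Each Rx $k\in\mathcal K_{eMBB}$ decodes $M_k^{(e)}$ from $Y_k^n$, all cooperation messages it received, and $(\mathbf A,\mathbf B)$. Achievability. For given $P,K$, a pair $(R^{(U)}(P),\bar R_K^{(e)}(P))$ is $D$-achievable if there exist rates $R_k^{(e)}$ with $\bar R_K^{(e)}\le \mathbb E_{\mathbf A,\mathbf B}\big[\frac1K\sum_{k\in\mathcal K_{eMBB}}R_k^{(e)}\big]$ and encoding functions (of the own message and $(\mathbf A,\mathbf B)$, obeying the power constraint $\frac1n\sum_{t=1}^n X_{k,t}^2\le P$ almost surely), URLLC decoding functions (of $Y_k^n$ and $(\mathbf A,\mathbf B)$), Rx-cooperation functions for $D$ rounds (of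 $Y_k^n$, the previously received Rx-cooperation messages and $(\mathbf A,\mathbf B)$) and eMBB decoding functions (of $Y_k^n$, all received Rx-cooperation messages and $(\mathbf A,\mathbf B)$) such that the probability that some URLLC message ($k\in\mathcal K_{URLLC}$) or some eMBB message ($k\in\mathcal K_{eMBB}$) is decoded incorrectly tends to $0$ as $n\to\infty$. A multiplexing gain (MG) pair $(S^{(U)},S^{(e)})$ is $D$-achievable if for all $P>0$ (and all $K$) there exist $D$-achievable rates with $S^{(U)}=\rho\rho_f\,\varlimsup_{K\to\infty}\varlimsup_{P\to\infty}\frac{R^{(U)}(P)}{\frac12\log P}$ and $S^{(e)}=\varlimsup_{K\to\infty}\varlimsup_{P\to\infty}\frac{\bar R_K^{(e)}(P)}{\frac12\log P}$. The fundamental MG region $\mathcal S_2^\star(D,\rho,\rho_f)$ is here the closure of the set of all $D$-achievable MG pairs under Model 2 with only Rx-cooperation.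
   Formalization: The channel gains are additionally assumed to be such that, for every run of at most D+1 consecutive users, the tridiagonal channel matrix of that run is invertible (in particular h_{k,k}≠0); for arbitrary gains h≥0 the claim fails, e.g. when all gains are 0. *)

theory Defs
  imports "HOL-Probability.Probability"
begin

section \<open>Activity\<close>

text \<open>An activity pattern maps user \<open>k\<close> to \<open>(A\<^sub>k, B\<^sub>k)\<close>.\<close>

type_synonym activity = "nat \<Rightarrow> bool \<times> bool"

definition user_pmf :: "real \<Rightarrow> real \<Rightarrow> (bool \<times> bool) pmf" where
  "user_pmf \<rho> \<rho>f =
     bind_pmf (bernoulli_pmf \<rho>) (\<lambda>a.
       map_pmf (Pair a) (if a then bernoulli_pmf \<rho>f else return_pmf False))"

definition activity_pmf :: "real \<Rightarrow> real \<Rightarrow> nat \<Rightarrow> activity pmf" where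
  "activity_pmf \<rho> \<rho>f K = Pi_pmf {1..K} (False, False) (\<lambda>_. user_pmf \<rho> \<rho>f)"

definition K_active :: "nat \<Rightarrow> activity \<Rightarrow> nat set" where
  "K_active K ab = {k \<in> {1..K}. fst (ab k)}"

definition K_URLLC :: "nat \<Rightarrow> activity \<Rightarrow> nat set" where
  "K_URLLC K ab = {k \<in> {1..K}. fst (ab k) \<and> snd (ab k)}"

definition K_eMBB :: "nat \<Rightarrow> activity \<Rightarrow> nat set" where
  "K_eMBB K ab = K_active K ab - K_URLLC K ab"


section \<open>Channel\<close>

text \<open>Users are numbered from \<open>1\<close>, so that for \<open>k = 1\<close> the index \<open>k - 1 = 0\<close> falls
  outside of \<open>S\<close>. The gain from Tx \<open>j\<close> to Rx \<open>k\<close> is \<open>h j k\<close>.\<close>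

definition nbrs :: "nat set \<Rightarrow> nat \<Rightarrow> nat set" where
  "nbrs S k = {k - 1, k + 1} \<inter> S"

definition noiseless :: "(nat \<Rightarrow> nat \<Rightarrow> real) \<Rightarrow> nat set \<Rightarrow> (nat \<Rightarrow> real) \<Rightarrow> nat \<Rightarrow> real" where
  "noiseless h S x k = h k k * x k + (\<Sum>j\<in>nbrs S k. h j k * x j)"

text \<open>The channel matrix of every run of at most \<open>L\<close> consecutive Tx/Rx pairs is nonsingular
  (has trivial kernel). Without this the multiplexing gain of such a run can fall short of its
  length, e.g. if all gains are \<open>0\<close>, or \<open>l = 2\<close> and all gains are \<open>1\<close>.\<close>

definition nonsingular_runs :: "(nat \<Rightarrow> nat \<Rightarrow> real) \<Rightarrow> nat \<Rightarrow> bool" where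
  "nonsingular_runs h L \<longleftrightarrow>
     (\<forall>i\<ge>1. \<forall>l\<le>L. \<forall>x.
        (\<forall>k\<in>{i..<i+l}. noiseless h {i..<i+l} x k = 0) \<longrightarrow> (\<forall>k\<in>{i..<i+l}. x k = 0))"

definition noise :: "nat \<Rightarrow> nat \<Rightarrow> (nat \<times> nat \<Rightarrow> real) measure" where
  "noise K n = PiM ({1..K} \<times> {1..n}) (\<lambda>_. density lborel std_normal_density)"


section \<open>Coding with receiver cooperation\<close>

text \<open>A cooperation message is a sequence of reals. This is no restriction on the capacity of
  the links: every standard Borel space embeds measurably into this space.
  The messages received by an Rx are indexed by (round, sender).\<close>

type_synonym coop_msg = "nat \<Rightarrow> real"
type_synonym history = "nat \<times> nat \<Rightarrow> coop_msg"

text \<open>\<open>coop c j k l\<close> produces the message that Rx \<open>k\<close> sends to Rx \<open>l\<close> in round \<open>j\<close>.\<close>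

record code =
  enc :: "nat \<Rightarrow> activity \<Rightarrow> nat \<Rightarrow> nat \<Rightarrow> real"
  dec_URLLC :: "nat \<Rightarrow> activity \<Rightarrow> (nat \<Rightarrow> real) \<Rightarrow> nat"
  coop :: "nat \<Rightarrow> nat \<Rightarrow> nat \<Rightarrow> activity \<Rightarrow> (nat \<Rightarrow> real) \<Rightarrow> history \<Rightarrow> coop_msg"
  dec_eMBB :: "nat \<Rightarrow> activity \<Rightarrow> (nat \<Rightarrow> real) \<Rightarrow> history \<Rightarrow> nat"

definition num_msgs :: "nat \<Rightarrow> real \<Rightarrow> nat" where
  "num_msgs n R = nat \<lfloor>2 powr (real n * R)\<rfloor>"

text \<open>Rate of the unique message of the active user \<open>k\<close>.\<close>

definition rate :: "nat \<Rightarrow> real \<Rightarrow> (nat \<Rightarrow> activity \<Rightarrow> real) \<Rightarrow> activity \<Rightarrow> nat \<Rightarrow> real" where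
  "rate K RU Rs ab k = (if k \<in> K_URLLC K ab then RU else Rs k ab)"

definition messages_pmf ::
    "nat \<Rightarrow> nat \<Rightarrow> real \<Rightarrow> (nat \<Rightarrow> activity \<Rightarrow> real) \<Rightarrow> activity \<Rightarrow> (nat \<Rightarrow> nat) pmf" where
  "messages_pmf K n RU Rs ab =
     Pi_pmf (K_active K ab) 0 (\<lambda>k. pmf_of_set {1..num_msgs n (rate K RU Rs ab k)})"

definition tx_input :: "nat \<Rightarrow> code \<Rightarrow> activity \<Rightarrow> (nat \<Rightarrow> nat) \<Rightarrow> nat \<Rightarrow> nat \<Rightarrow> real" where
  "tx_input K c ab w t k = (if k \<in> K_active K ab then enc c k ab (w k) t else 0)"

definition rx_output ::
    "(nat \<Rightarrow> nat \<Rightarrow> real) \<Rightarrow> nat \<Rightarrow> nat \<Rightarrow> code \<Rightarrow> activity \<Rightarrow> (nat \<Rightarrow> nat) \<Rightarrow> (nat \<times> nat \<Rightarrow> real)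
      \<Rightarrow> nat \<Rightarrow> nat \<Rightarrow> real" where
  "rx_output h K n c ab w z k =
     (\<lambda>t\<in>{1..n}. noiseless h {1..K} (tx_input K c ab w t) k + z (k, t))"

text \<open>Messages received by Rx \<open>k\<close> up to and including the given round, when the channel
  outputs are \<open>y\<close>.\<close>

primrec received ::
    "nat \<Rightarrow> code \<Rightarrow> activity \<Rightarrow> (nat \<Rightarrow> nat \<Rightarrow> real) \<Rightarrow> nat \<Rightarrow> nat \<Rightarrow> history" where
  "received K c ab y 0 = (\<lambda>k. \<lambda>_\<in>{}. undefined)"
| "received K c ab y (Suc j) = (\<lambda>k. \<lambda>(i, l)\<in>{1..Suc j} \<times> nbrs (K_active K ab) k.
     if i = Suc j then coop c (Suc j) l k ab (y l) (received K c ab y j l)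
     else received K c ab y j k (i, l))"

definition output_space :: "nat \<Rightarrow> (nat \<Rightarrow> real) measure" where
  "output_space n = PiM {1..n} (\<lambda>_. borel)"

definition coop_msg_space :: "coop_msg measure" where
  "coop_msg_space = PiM UNIV (\<lambda>_. borel)"

definition history_space :: "nat \<Rightarrow> activity \<Rightarrow> nat \<Rightarrow> nat \<Rightarrow> history measure" where
  "history_space K ab j k =
     PiM ({1..j} \<times> nbrs (K_active K ab) k) (\<lambda>_. coop_msg_space)"

text \<open>Decoders and cooperation functions have to be measurable, since \<^const>\<open>measure\<close> is \<open>0\<close> on
  nonmeasurable error events. Conditions that hold almost surely in the (discrete) activities
  and messages are imposed on the support of their distributions.\<close>

definition valid_code ::
    "nat \<Rightarrow> real \<Rightarrow> real \<Rightarrow> real \<Rightarrow> nat \<Rightarrow> nat \<Rightarrow> real \<Rightarrow> (nat \<Rightarrow> activity \<Rightarrow> real) \<Rightarrow> code \<Rightarrow> bool"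
  where
  "valid_code D \<rho> \<rho>f P K n RU Rs c \<longleftrightarrow>
     (\<forall>ab\<in>set_pmf (activity_pmf \<rho> \<rho>f K).
        (\<forall>k\<in>K_active K ab. \<forall>m\<in>{1..num_msgs n (rate K RU Rs ab k)}.
           1 / real n * (\<Sum>t=1..n. (enc c k ab m t)\<^sup>2) \<le> P) \<and>
        (\<forall>k\<in>K_URLLC K ab.
           dec_URLLC c k ab \<in> output_space n \<rightarrow>\<^sub>M count_space UNIV) \<and>
        (\<forall>j\<in>{1..D}. \<forall>k\<in>K_active K ab. \<forall>l\<in>nbrs (K_active K ab) k.
           (\<lambda>(y, r). coop c j k l ab y r)
             \<in> output_space n \<Otimes>\<^sub>M history_space K ab (j - 1) k \<rightarrow>\<^sub>M coop_msg_space) \<and>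
        (\<forall>k\<in>K_eMBB K ab.
           (\<lambda>(y, r). dec_eMBB c k ab y r)
             \<in> output_space n \<Otimes>\<^sub>M history_space K ab D k \<rightarrow>\<^sub>M count_space UNIV))"

definition decoding_error ::
    "(nat \<Rightarrow> nat \<Rightarrow> real) \<Rightarrow> nat \<Rightarrow> nat \<Rightarrow> nat \<Rightarrow> code \<Rightarrow> activity \<Rightarrow> (nat \<Rightarrow> nat)
      \<Rightarrow> (nat \<times> nat \<Rightarrow> real) \<Rightarrow> bool" where
  "decoding_error h D K n c ab w z \<longleftrightarrow>
     (let y = rx_output h K n c ab w z in
       (\<exists>k\<in>K_URLLC K ab. dec_URLLC c k ab (y k) \<noteq> w k) \<or>
       (\<exists>k\<in>K_eMBB K ab. dec_eMBB c k ab (y k) (received K c ab y D k) \<noteq> w k))"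

definition error_prob ::
    "(nat \<Rightarrow> nat \<Rightarrow> real) \<Rightarrow> nat \<Rightarrow> real \<Rightarrow> real \<Rightarrow> nat \<Rightarrow> nat \<Rightarrow> real \<Rightarrow> (nat \<Rightarrow> activity \<Rightarrow> real)
      \<Rightarrow> code \<Rightarrow> real" where
  "error_prob h D \<rho> \<rho>f K n RU Rs c =
     measure_pmf.expectation (activity_pmf \<rho> \<rho>f K) (\<lambda>ab.
       measure_pmf.expectation (messages_pmf K n RU Rs ab) (\<lambda>w.
         measure (noise K n) {z \<in> space (noise K n). decoding_error h D K n c ab w z}))"


section \<open>Achievable rates and multiplexing gains\<close>

definition achievable_rates ::
    "(nat \<Rightarrow> nat \<Rightarrow> real) \<Rightarrow> nat \<Rightarrow> real \<Rightarrow> real \<Rightarrow> real \<Rightarrow> nat \<Rightarrow> real \<Rightarrow> real \<Rightarrow> bool" where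
  "achievable_rates h D \<rho> \<rho>f P K RU Rbar \<longleftrightarrow>
     0 \<le> RU \<and> 0 \<le> Rbar \<and>
     (\<exists>Rs :: nat \<Rightarrow> activity \<Rightarrow> real.
        (\<forall>k ab. 0 \<le> Rs k ab) \<and>
        Rbar \<le> measure_pmf.expectation (activity_pmf \<rho> \<rho>f K)
                 (\<lambda>ab. 1 / real K * (\<Sum>k\<in>K_eMBB K ab. Rs k ab)) \<and>
        (\<exists>c :: nat \<Rightarrow> code.
           (\<forall>n\<ge>1. valid_code D \<rho> \<rho>f P K n RU Rs (c n)) \<and>
           (\<lambda>n. error_prob h D \<rho> \<rho>f K n RU Rs (c n)) \<longlonglongrightarrow> 0))"

text \<open>The logarithm is binary, as rates are in bits.\<close>

definition MG_limsup :: "(nat \<Rightarrow> real \<Rightarrow> real) \<Rightarrow> ereal" where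
  "MG_limsup R =
     Limsup sequentially (\<lambda>K. Limsup at_top (\<lambda>P. ereal (R K P / (1 / 2 * log 2 P))))"

definition achievable_MG ::
    "(nat \<Rightarrow> nat \<Rightarrow> real) \<Rightarrow> nat \<Rightarrow> real \<Rightarrow> real \<Rightarrow> real \<times> real \<Rightarrow> bool" where
  "achievable_MG h D \<rho> \<rho>f S \<longleftrightarrow>
     (\<exists>RU Rbar :: nat \<Rightarrow> real \<Rightarrow> real.
        (\<forall>K\<ge>1. \<forall>P>0. achievable_rates h D \<rho> \<rho>f P K (RU K P) (Rbar K P)) \<and>
        ereal (fst S) = ereal (\<rho> * \<rho>f) * MG_limsup RU \<and>
        ereal (snd S) = MG_limsup Rbar)"

definition MG_region ::
    "(nat \<Rightarrow> nat \<Rightarrow> real) \<Rightarrow> nat \<Rightarrow> real \<Rightarrow> real \<Rightarrow> (real \<times> real) set" where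
  "MG_region h D \<rho> \<rho>f = closure {S. achievable_MG h D \<rho> \<rho>f S}"


section \<open>The inner bound\<close>

definition eMBB_bound :: "nat \<Rightarrow> real \<Rightarrow> real \<Rightarrow> real" where
  "eMBB_bound D \<rho> \<rho>f =
     \<rho> * (1 - \<rho>f)
     - (1 - \<rho> * (1 - \<rho>f)) * \<rho> ^ (D + 2) * (1 - \<rho>f) ^ (D + 2)
       / (1 - \<rho> ^ (D + 2) * (1 - \<rho>f) ^ (D + 2))"

definition slope_M :: "nat \<Rightarrow> real \<Rightarrow> real \<Rightarrow> real" where
  "slope_M D \<rho> \<rho>f =
     2 * (1 - \<rho>f) / \<rho>f
     - 2 * (1 - \<rho> * (1 - \<rho>f)) * \<rho> ^ (D + 1) * (1 - \<rho>f) ^ (D + 2)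
       / (\<rho>f * (1 - \<rho> ^ (D + 2) * (1 - \<rho>f) ^ (D + 2)))
     + \<rho> ^ 3 * \<rho>f * (1 - \<rho>f)\<^sup>2 / (1 - \<rho>\<^sup>2 * (1 - \<rho>f)\<^sup>2)
       * (2 / (1 - \<rho>\<^sup>2 * (1 - \<rho>f)\<^sup>2)
          - \<rho> ^ D * (1 - \<rho>f) ^ D / (1 - \<rho> ^ (D + 2) * (1 - \<rho>f) ^ (D + 2)))
     - (1 - \<rho>f) * ((1 - \<rho> * (1 - \<rho>f))\<^sup>2 + (1 - \<rho>)\<^sup>2) / (\<rho>f * (1 - \<rho> * (1 - \<rho>f)))
       * (1 / (1 - \<rho> * (1 - \<rho>f))
          - \<rho> ^ (D + 1) * (1 - \<rho>f) ^ (D + 1) / (1 - \<rho> ^ (D + 2) * (1 - \<rho>f) ^ (D + 2)))"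

end

theory Submission
  imports Defs
begin

text \<open>With \<open>q = \<rho> (1 - \<rho>f)\<close>, \<open>u = \<rho> \<rho>f\<close>, we time-share three phases. In phase \<open>0\<close> only eMBB users
  transmit, and every \<open>(D + 2)\<close>-th user of each maximal run of eMBB users is silenced. In phases \<open>1\<close>
  and \<open>2\<close> the odd, respectively even, URLLC users transmit as well, and the eMBB users next to them are
  silenced too. The transmitters then split into noninteracting segments that are single URLLC users
  or runs of at most \<open>D + 1\<close> eMBB users, so \<open>D\<close> rounds of forwarding provide every Rx with all outputs
  of its segment, which determine the inputs because the channel matrix of the segment is nonsingular.
  If phases \<open>1\<close> and \<open>2\<close> each take a fraction \<open>S\<^sup>U / u\<close> of the time, this achieves at least the claimed
  gain: for fixed \<open>q\<close>, the surplus is \<open>S\<^sup>U\<close> times an affine function of \<open>u\<close> that is nonnegative at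
  \<open>u = 0\<close> and \<open>u = 1 - q\<close>.

  Since only the growth of the rates in \<open>log P\<close> matters, Gaussian codebooks are not needed. Users send
  PAM symbols with a spacing that does not depend on \<open>P\<close>, along the words of a Gilbert--Varshamov code
  with relative distance \<open>2 \<delta>\<close>. If the spacing is large in terms of \<open>\<delta>\<close>, then by a Chernoff bound the
  noise exceeds the decision threshold in at most a fraction \<open>\<delta>\<close> of the time instants, except with
  exponentially small probability. A multiplexing gain of order \<open>\<delta>\<close> is lost, which the closure in
  the definition of the region absorbs.\<close>

section \<open>Codes of large minimum distance\<close>

text \<open>A word of the ball is determined by its set of disagreements with \<open>c\<close> and
  its values there: at most \<open>2 ^ card T\<close> sets, and at most \<open>Q ^ s\<close> value
  patterns for each. This is cruder than a binomial sum, but the factor \<open>2 ^ card T\<close>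
  costs only one bit per time instant, which is negligible against \<open>log 2 Q\<close>.\<close>

lemma card_hamming_ball_le:
  fixes Q s :: nat
  assumes "finite T" and "1 \<le> Q"
  shows "card {w \<in> T \<rightarrow>\<^sub>E {..<Q}. card {t \<in> T. w t \<noteq> c t} \<le> s} \<le> 2 ^ card T * Q ^ s"
proof -
  let ?B = "{w \<in> T \<rightarrow>\<^sub>E {..<Q}. card {t \<in> T. w t \<noteq> c t} \<le> s}"
  let ?S = "SIGMA E:{E \<in> Pow T. card E \<le> s}. E \<rightarrow>\<^sub>E {..<Q}"
  let ?f = "\<lambda>w. ({t \<in> T. w t \<noteq> c t}, restrict w {t \<in> T. w t \<noteq> c t})"
  have fin: "finite E" if "E \<subseteq> T" for E
    using that assms finite_subset by blast
  have "inj_on ?f ?B"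
  proof (rule inj_onI)
    fix v w assume vw: "v \<in> ?B" "w \<in> ?B" and eq: "?f v = ?f w"
    have "v t = w t" if "t \<in> T" for t
    proof (cases "v t = c t")
      case True
      then have "t \<notin> {t \<in> T. w t \<noteq> c t}" using eq by auto
      then show ?thesis using True that by auto
    next
      case False
      then have "t \<in> {t \<in> T. v t \<noteq> c t}" "t \<in> {t \<in> T. w t \<noteq> c t}" using eq that by auto
      then show ?thesis using eq by (metis (no_types, lifting) prod.inject restrict_apply')
    qed
    then show "v = w" using vw by (auto intro: PiE_ext)
  qed
  moreover have "?f ` ?B \<subseteq> ?S"
    by auto
  moreover have "finite ?S"
    using assms fin by (intro finite_SigmaI finite_PiE) auto
  ultimately have "card ?B \<le> card ?S"
    by (rule card_inj_on_le)
  also have "\<dots> = (\<Sum>E | E \<in> Pow T \<and> card E \<le> s. Q ^ card E)"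
    using assms fin by (subst card_SigmaI) (auto simp: card_PiE finite_PiE)
  also have "\<dots> \<le> (\<Sum>E | E \<in> Pow T \<and> card E \<le> s. Q ^ s)"
    using assms by (intro sum_mono power_increasing) auto
  also have "\<dots> \<le> 2 ^ card T * Q ^ s"
    using assms card_mono[of "Pow T" "{E. E \<subseteq> T \<and> card E \<le> s}"] by (auto simp: card_Pow)
  finally show ?thesis .
qed

text \<open>In a maximal code of distance greater than \<open>s\<close>, the balls of radius
  \<open>s\<close> around the codewords cover all words, since an uncovered word could be added.
  Comparing cardinalities gives the size.\<close>

lemma Gilbert_Varshamov:
  fixes Q s :: nat
  assumes "finite T" and "1 \<le> Q"
  obtains C where "C \<subseteq> T \<rightarrow>\<^sub>E {..<Q}"
    and "\<And>c c'. c \<in> C \<Longrightarrow> c' \<in> C \<Longrightarrow> c \<noteq> c' \<Longrightarrow> s < card {t \<in> T. c t \<noteq> c' t}"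
    and "Q ^ card T \<le> card C * (2 ^ card T * Q ^ s)"
proof -
  let ?W = "T \<rightarrow>\<^sub>E {..<Q}"
  define \<F> where "\<F> = {C. C \<subseteq> ?W \<and> (\<forall>c\<in>C. \<forall>c'\<in>C. c \<noteq> c' \<longrightarrow> s < card {t \<in> T. c t \<noteq> c' t})}"
  have finW: "finite ?W" using assms by (intro finite_PiE) auto
  have "finite \<F>" by (rule finite_subset[of _ "Pow ?W"]) (auto simp: \<F>_def finW)
  moreover have "{} \<in> \<F>" by (auto simp: \<F>_def)
  ultimately obtain C where C: "C \<in> \<F>" and max: "\<And>C'. C' \<in> \<F> \<Longrightarrow> C \<subseteq> C' \<Longrightarrow> C' = C"
    using finite_has_maximal[of \<F>] by (metis empty_iff)
  let ?B = "\<lambda>c. {w \<in> ?W. card {t \<in> T. w t \<noteq> c t} \<le> s}"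
  have CW: "C \<subseteq> ?W" using C by (auto simp: \<F>_def)
  have "?W \<subseteq> (\<Union>c\<in>C. ?B c)"
  proof (rule subsetI, rule ccontr)
    fix w assume w: "w \<in> ?W" and "w \<notin> (\<Union>c\<in>C. ?B c)"
    then have far: "s < card {t \<in> T. w t \<noteq> c t}" if "c \<in> C" for c
      using that by force
    have far': "s < card {t \<in> T. c t \<noteq> w t}" if "c \<in> C" for c
      using far[OF that] by (simp add: eq_commute[of "c _" "w _"])
    have "insert w C \<in> \<F>"
      using C w far far' unfolding \<F>_def by auto
    then have "w \<in> C" using max[of "insert w C"] by blast
    with far[of w] show False by simp
  qed
  then have "card ?W \<le> card (\<Union>c\<in>C. ?B c)"
    using finW CW by (intro card_mono) (auto intro: finite_subset)
  also have "\<dots> \<le> (\<Sum>c\<in>C. card (?B c))"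
    using finW CW by (intro card_UN_le) (auto intro: finite_subset)
  also have "\<dots> \<le> (\<Sum>c\<in>C. 2 ^ card T * Q ^ s)"
    by (intro sum_mono card_hamming_ball_le assms)
  finally have "Q ^ card T \<le> card C * (2 ^ card T * Q ^ s)"
    using assms by (simp add: card_PiE)
  moreover have "s < card {t \<in> T. c t \<noteq> c' t}" if "c \<in> C" "c' \<in> C" "c \<noteq> c'" for c c'
    using C that by (simp add: \<F>_def)
  ultimately show thesis by (intro that[OF CW])
qed

text \<open>The alternative \<open>M \<le> 1\<close> serves users whose rate is too small for the
  counting bound: a single message needs no distance.\<close>

lemma codebook_exists:
  fixes Q s M :: nat
  assumes "finite T" and Q: "1 \<le> Q" and M: "M \<le> 1 \<or> M * (2 ^ card T * Q ^ s) \<le> Q ^ card T"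
  shows "\<exists>cw. (\<forall>m t. cw m t < Q) \<and>
           (\<forall>m\<in>{1..M}. \<forall>m'\<in>{1..M}. m \<noteq> m' \<longrightarrow> s < card {t \<in> T. cw m t \<noteq> cw m' t})"
  using M
proof
  assume "M \<le> 1"
  then show ?thesis using Q by (intro exI[of _ "\<lambda>_ _. 0"]) auto
next
  assume le: "M * (2 ^ card T * Q ^ s) \<le> Q ^ card T"
  obtain C where C: "C \<subseteq> T \<rightarrow>\<^sub>E {..<Q}"
    and dist: "\<And>c c'. c \<in> C \<Longrightarrow> c' \<in> C \<Longrightarrow> c \<noteq> c' \<Longrightarrow> s < card {t \<in> T. c t \<noteq> c' t}"
    and "Q ^ card T \<le> card C * (2 ^ card T * Q ^ s)"
    using Gilbert_Varshamov[OF assms(1,2), of s] by blast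
  then have "M * (2 ^ card T * Q ^ s) \<le> card C * (2 ^ card T * Q ^ s)" using le by linarith
  then have "card {1..M} \<le> card C" using Q by simp
  moreover have "finite C"
    using C assms by (meson finite_PiE finite_lessThan finite_subset)
  ultimately obtain f where f: "f ` {1..M} \<subseteq> C" "inj_on f {1..M}"
    by (meson card_le_inj finite_atLeastAtMost)
  \<comment> \<open>The default 0 keeps all symbols below \<open>Q\<close>, also for irrelevant
    messages and times.\<close>
  define cw where "cw = (\<lambda>m t. if m \<in> {1..M} \<and> t \<in> T then f m t else 0)"
  have "cw m t < Q" for m t
  proof (cases "m \<in> {1..M} \<and> t \<in> T")
    case True
    then have "f m \<in> T \<rightarrow>\<^sub>E {..<Q}" using C f by blast
    then show ?thesis using True by (auto simp: cw_def)
  qed (use Q in \<open>auto simp: cw_def\<close>)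
  moreover have "s < card {t \<in> T. cw m t \<noteq> cw m' t}"
    if "m \<in> {1..M}" "m' \<in> {1..M}" "m \<noteq> m'" for m m'
  proof -
    have "s < card {t \<in> T. f m t \<noteq> f m' t}"
      using that f by (intro dist) (auto dest: inj_onD)
    also have "{t \<in> T. f m t \<noteq> f m' t} = {t \<in> T. cw m t \<noteq> cw m' t}"
      using that by (auto simp: cw_def)
    finally show ?thesis .
  qed
  ultimately show ?thesis by blast
qed


section \<open>Nonsingular runs\<close>

lemma noiseless_scale: "noiseless h S (\<lambda>j. s * x j) k = s * noiseless h S x k"
  by (simp add: noiseless_def sum_distrib_left algebra_simps)

lemma noiseless_diff: "noiseless h S (\<lambda>j. x j - x' j) k = noiseless h S x k - noiseless h S x' k"
  by (simp add: noiseless_def sum_subtractf algebra_simps)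

lemma noiseless_cong:
  assumes "x k = x' k" and "\<And>j. j \<in> nbrs S k \<Longrightarrow> x j = x' j"
  shows "noiseless h S x k = noiseless h S x' k"
  using assms by (simp add: noiseless_def)

text \<open>Vectors indexed by \<open>S\<close> are represented by functions on all of \<nat> that
  vanish outside of \<open>S\<close>, so that compactness of the cube is Tychonoff's theorem for the
  product topology.\<close>

lemma compact_cube:
  fixes S :: "nat set"
  shows "compact {x :: nat \<Rightarrow> real. \<forall>k. x k \<in> (if k \<in> S then {-1..1} else {0})}"
proof -
  have "compactin (product_topology (\<lambda>_. euclidean) UNIV)
      (PiE UNIV (\<lambda>k. if k \<in> S then {-1..1} else {0 :: real}))"
    by (subst compactin_PiE) (auto simp: compactin_euclidean_iff)
  moreover have "PiE UNIV (\<lambda>k. if k \<in> S then {-1..1} else {0 :: real}) =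
      {x. \<forall>k. x k \<in> (if k \<in> S then {-1..1} else {0})}"
    by (auto simp: PiE_def Pi_def)
  ultimately show ?thesis
    by (simp add: euclidean_product_topology compactin_euclidean_iff)
qed

text \<open>An injective linear map on a finite-dimensional space is bounded below. This is the
  compactness argument in the maximum norm, done separately on each pair of opposite faces of the
  cube.\<close>

lemma nonsingular_lower_bound:
  assumes "finite S"
    and ker: "\<And>x. (\<forall>k\<in>S. noiseless h S x k = 0) \<Longrightarrow> (\<forall>k\<in>S. x k = 0)"
  shows "\<exists>c>0. \<forall>x e. (\<forall>k\<in>S. \<bar>noiseless h S x k\<bar> \<le> e) \<longrightarrow> (\<forall>k\<in>S. c * \<bar>x k\<bar> \<le> e)"
proof -
  define C where "C = {x :: nat \<Rightarrow> real. \<forall>k. x k \<in> (if k \<in> S then {-1..1} else {0})}"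
  define F where "F = (\<lambda>x. \<Sum>k\<in>S. \<bar>noiseless h S x k\<bar>)"
  have cont: "continuous_on A F" for A
    unfolding F_def noiseless_def
    by (intro continuous_intros continuous_on_product_then_coordinatewise)
  have ev: "\<forall>k\<in>S. \<exists>c>0. \<forall>x\<in>C. \<bar>x k\<bar> = 1 \<longrightarrow> c \<le> F x"
  proof
    fix k0 assume k0: "k0 \<in> S"
    let ?C = "C \<inter> {x. \<bar>x k0\<bar> = 1}"
    have "closed {x :: nat \<Rightarrow> real. \<bar>x k0\<bar> = 1}"
      by (intro closed_Collect_eq continuous_intros continuous_on_product_then_coordinatewise)
    then have "compact ?C"
      unfolding C_def by (intro compact_Int_closed compact_cube)
    have pos: "F x > 0" if "x \<in> ?C" for x
    proof (rule ccontr)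
      assume "\<not> F x > 0"
      moreover have "F x \<ge> 0" by (auto simp: F_def intro: sum_nonneg)
      ultimately have "F x = 0" by simp
      then have "\<forall>k\<in>S. noiseless h S x k = 0"
        unfolding F_def using \<open>finite S\<close> by (subst (asm) sum_nonneg_eq_0_iff) auto
      from ker[OF this] k0 that show False by auto
    qed
    show "\<exists>c>0. \<forall>x\<in>C. \<bar>x k0\<bar> = 1 \<longrightarrow> c \<le> F x"
    proof (cases "?C = {}")
      case True
      then show ?thesis by (auto intro!: exI[of _ 1])
    next
      case False
      from continuous_attains_inf[OF \<open>compact ?C\<close> False cont]
      obtain x0 where "x0 \<in> ?C" "\<forall>y\<in>?C. F x0 \<le> F y" by blast
      then show ?thesis using pos by (intro exI[of _ "F x0"]) auto
    qed
  qed
  then obtain c where c': "\<forall>k\<in>S. c k > 0 \<and> (\<forall>x\<in>C. \<bar>x k\<bar> = 1 \<longrightarrow> c k \<le> F x)"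
    by (rule bchoice[THEN exE])
  have c: "c k > 0" if "k \<in> S" for k
    using c' that by blast
  have cF: "c k \<le> F x" if "k \<in> S" "x \<in> C" "\<bar>x k\<bar> = 1" for k x
    using c' that by blast
  show ?thesis
  proof (cases "S = {}")
    case True
    then show ?thesis by (auto intro: exI[of _ 1])
  next
    case False
    \<comment> \<open>\<open>m\<close> bounds \<open>F\<close>, a sum of \<open>card S\<close>
      outputs, on the boundary of the cube. Dividing by \<open>card S\<close> passes from the sum to
      a bound on the single outputs.\<close>
    define m where "m = Min (c ` S)"
    have m: "m > 0" "\<And>k. k \<in> S \<Longrightarrow> m \<le> c k"
      using c False \<open>finite S\<close> by (auto simp: m_def)
    have cS: "card S > 0" using False \<open>finite S\<close> by (simp add: card_gt_0_iff)
    have "m / card S * \<bar>x k\<bar> \<le> e"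
      if bd: "\<forall>k\<in>S. \<bar>noiseless h S x k\<bar> \<le> e" and k: "k \<in> S" for x e k
    proof -
      obtain k0 where k0: "k0 \<in> S" and mx: "\<And>k. k \<in> S \<Longrightarrow> \<bar>x k\<bar> \<le> \<bar>x k0\<bar>"
      proof -
        have "Max ((\<lambda>k. \<bar>x k\<bar>) ` S) \<in> (\<lambda>k. \<bar>x k\<bar>) ` S"
          using False \<open>finite S\<close> by (intro Max_in) auto
        then obtain k0 where "k0 \<in> S" "Max ((\<lambda>k. \<bar>x k\<bar>) ` S) = \<bar>x k0\<bar>" by auto
        then show thesis using that[of k0] \<open>finite S\<close> by (metis Max_ge finite_imageI imageI)
      qed
      have e0: "e \<ge> 0" using bd k by (meson abs_ge_zero order_trans)
      show ?thesis
      proof (cases "x k0 = 0")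
        case True
        then have "x k = 0" using mx[OF k] by simp
        then show ?thesis using e0 by simp
      next
        case False
        define s where "s = 1 / \<bar>x k0\<bar>"
        have s: "s > 0" "s * \<bar>x k0\<bar> = 1" using False by (auto simp: s_def)
        \<comment> \<open>Normalised so that the largest coordinate has modulus 1, and set to 0
          outside of \<open>S\<close>, \<open>x'\<close> lies in the cube \<open>C\<close>.\<close>
        define x' where "x' = (\<lambda>j. s * (if j \<in> S then x j else 0))"
        have "\<bar>x' j\<bar> \<le> 1" for j
          using mx[of j] s mult_left_mono[of "\<bar>x j\<bar>" "\<bar>x k0\<bar>" s] by (auto simp: x'_def abs_mult)
        then have x'1: "\<bar>x' j\<bar> \<le> 1" for j .
        have "x' j \<in> (if j \<in> S then {-1..1} else {0})" for j
          using x'1[of j, unfolded abs_le_iff]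
          by (cases "j \<in> S") (auto simp: x'_def minus_le_iff)
        then have "x' \<in> C" unfolding C_def by blast
        moreover have "\<bar>x' k0\<bar> = 1" using s k0 by (simp add: x'_def abs_mult)
        ultimately have "c k0 \<le> F x'" by (rule cF[OF k0])
        then have "m \<le> F x'" using m(2)[OF k0] by linarith
        also have "F x' = (\<Sum>k\<in>S. s * \<bar>noiseless h S x k\<bar>)"
          unfolding F_def
        proof (intro sum.cong refl)
          fix k assume k: "k \<in> S"
          have "noiseless h S x' k = s * noiseless h S (\<lambda>j. if j \<in> S then x j else 0) k"
            unfolding x'_def by (rule noiseless_scale)
          also have "noiseless h S (\<lambda>j. if j \<in> S then x j else 0) k = noiseless h S x k"
            using k by (intro noiseless_cong) (auto simp: nbrs_def)
          finally show "\<bar>noiseless h S x' k\<bar> = s * \<bar>noiseless h S x k\<bar>"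
            using s by (simp add: abs_mult)
        qed
        also have "\<dots> \<le> (\<Sum>k\<in>S. s * e)"
          using bd s by (intro sum_mono mult_left_mono) auto
        finally have "m \<le> card S * s * e" by simp
        then have "m * \<bar>x k0\<bar> \<le> card S * s * e * \<bar>x k0\<bar>" by (intro mult_right_mono) auto
        also have "\<dots> = card S * e" using s by (simp add: mult.assoc mult.left_commute)
        finally have "m / card S * \<bar>x k0\<bar> \<le> e" using cS by (simp add: field_simps)
        moreover have "m / card S * \<bar>x k\<bar> \<le> m / card S * \<bar>x k0\<bar>"
          using mx[OF k] m by (intro mult_left_mono) auto
        ultimately show ?thesis by linarith
      qed
    qed
    then show ?thesis using m cS by (intro exI[of _ "m / card S"]) auto
  qed
qed

text \<open>Only finitely many runs lie in \<open>{1..K}\<close>, so the minimum of their constants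
  serves all of them.\<close>

lemma nonsingular_runs_lower_bound:
  assumes ns: "nonsingular_runs h L"
  obtains c where "c > 0" and
    "\<And>a b x e k. 1 \<le> a \<Longrightarrow> b \<le> K \<Longrightarrow> Suc b \<le> a + L \<Longrightarrow>
       (\<And>k. k \<in> {a..b} \<Longrightarrow> \<bar>noiseless h {a..b} x k\<bar> \<le> e) \<Longrightarrow> k \<in> {a..b} \<Longrightarrow> c * \<bar>x k\<bar> \<le> e"
proof -
  let ?R = "{(a, b). 1 \<le> a \<and> a \<le> K \<and> b \<le> K \<and> Suc b \<le> a + L}"
  have fin: "finite ?R" by (rule finite_subset[of _ "{..K} \<times> {..K}"]) auto
  have "\<forall>r\<in>?R. \<exists>c>0. \<forall>x e. (\<forall>k\<in>{fst r..snd r}. \<bar>noiseless h {fst r..snd r} x k\<bar> \<le> e) \<longrightarrow>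
      (\<forall>k\<in>{fst r..snd r}. c * \<bar>x k\<bar> \<le> e)"
  proof
    fix r assume r: "r \<in> ?R"
    have eq: "{fst r..snd r} = {fst r..<fst r + (Suc (snd r) - fst r)}" by auto
    show "\<exists>c>0. \<forall>x e. (\<forall>k\<in>{fst r..snd r}. \<bar>noiseless h {fst r..snd r} x k\<bar> \<le> e) \<longrightarrow>
      (\<forall>k\<in>{fst r..snd r}. c * \<bar>x k\<bar> \<le> e)"
      unfolding eq
    proof (rule nonsingular_lower_bound)
      fix x assume "\<forall>k\<in>{fst r..<fst r + (Suc (snd r) - fst r)}.
        noiseless h {fst r..<fst r + (Suc (snd r) - fst r)} x k = 0"
      moreover have "1 \<le> fst r" "Suc (snd r) - fst r \<le> L" using r by auto
      ultimately show "\<forall>k\<in>{fst r..<fst r + (Suc (snd r) - fst r)}. x k = 0"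
        using ns unfolding nonsingular_runs_def by blast
    qed simp
  qed
  then obtain c where c': "\<forall>r\<in>?R. c r > 0 \<and> (\<forall>x e.
      (\<forall>k\<in>{fst r..snd r}. \<bar>noiseless h {fst r..snd r} x k\<bar> \<le> e) \<longrightarrow>
      (\<forall>k\<in>{fst r..snd r}. c r * \<bar>x k\<bar> \<le> e))"
    by (rule bchoice[THEN exE])
  have c: "c r > 0" if "r \<in> ?R" for r
    using c' that by blast
  have cb: "c r * \<bar>x k\<bar> \<le> e" if "r \<in> ?R"
    "\<forall>k\<in>{fst r..snd r}. \<bar>noiseless h {fst r..snd r} x k\<bar> \<le> e" "k\<in>{fst r..snd r}" for r x e k
    using c' that by blast
  \<comment> \<open>The element 1 keeps the set nonempty even if there is no run to
    consider.\<close>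
  define m where "m = Min (insert 1 (c ` ?R))"
  have m: "m > 0" "\<And>r. r \<in> ?R \<Longrightarrow> m \<le> c r"
    using c fin by (auto simp: m_def)
  show thesis
  proof (rule that[OF m(1)])
    fix a b x e k
    assume *: "1 \<le> a" "b \<le> K" "Suc b \<le> a + L"
      and le: "\<And>k. k \<in> {a..b} \<Longrightarrow> \<bar>noiseless h {a..b} x k\<bar> \<le> e" and k: "k \<in> {a..b}"
    have r: "(a, b) \<in> ?R" using * k by auto
    have "m * \<bar>x k\<bar> \<le> c (a, b) * \<bar>x k\<bar>" using m(2)[OF r] by (intro mult_right_mono) auto
    also have "\<dots> \<le> e" using cb[OF r, of x e k] le k by auto
    finally show "m * \<bar>x k\<bar> \<le> e" .
  qed
qed


section \<open>Noise\<close>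

text \<open>Weighting the standard normal density by \<open>exp (z\<^sup>2 / 4)\<close> gives
  \<open>sqrt 2\<close> times the normal density of variance 2.\<close>

lemma nn_integral_exp_square_std_normal:
  "(\<integral>\<^sup>+z. ennreal (exp (z\<^sup>2 / 4)) \<partial>density lborel std_normal_density) = ennreal (sqrt 2)"
proof -
  have eq: "std_normal_density z * exp (z\<^sup>2 / 4) = sqrt 2 * normal_density 0 (sqrt 2) z" for z
    by (simp add: normal_density_def std_normal_density_def field_simps real_sqrt_mult
        flip: exp_add)
  interpret N: prob_space "density lborel (normal_density 0 (sqrt 2))"
    by (rule prob_space_normal_density) simp
  have "(\<integral>\<^sup>+z. ennreal (normal_density 0 (sqrt 2) z) \<partial>lborel) = 1"
    using N.emeasure_space_1 by (simp add: emeasure_density)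
  moreover have "(\<integral>\<^sup>+z. ennreal (exp (z\<^sup>2 / 4)) \<partial>density lborel std_normal_density) =
      (\<integral>\<^sup>+z. ennreal (sqrt 2) * ennreal (normal_density 0 (sqrt 2) z) \<partial>lborel)"
    by (subst nn_integral_density) (simp_all add: eq flip: ennreal_mult)
  ultimately show ?thesis by (simp add: nn_integral_cmult)
qed

text \<open>Chernoff bound: the exponential of a quarter of the noise energy has mean
  \<open>sqrt 2 ^ (K * n)\<close> by independence, and on the event it is at least
  \<open>exp 1 ^ (K * n)\<close>. The ratio decays exponentially because
  \<open>sqrt 2 < exp 1\<close>.\<close>

lemma noise_tail:
  "measure (noise K n) {z \<in> space (noise K n). 4 * real (K * n) \<le> (\<Sum>i\<in>{1..K}\<times>{1..n}. (z i)\<^sup>2)}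
     \<le> (sqrt 2 / exp 1) ^ (K * n)"
proof -
  let ?I = "{1..K}\<times>{1..n}"
  let ?M = "\<lambda>_ :: nat \<times> nat. density lborel std_normal_density"
  interpret P: prob_space "?M i" for i by (rule prob_space_normal_density) simp
  interpret product_sigma_finite ?M by unfold_locales
  let ?A = "{z \<in> space (noise K n). 4 * real (K * n) \<le> (\<Sum>i\<in>?I. (z i)\<^sup>2)}"
  have ms[measurable]: "(\<lambda>z. z i) \<in> borel_measurable (noise K n)" if "i \<in> ?I" for i
    using measurable_component_singleton[OF that, of ?M] by (simp add: noise_def)
  have "(\<integral>\<^sup>+z. (\<Prod>i\<in>?I. ennreal (exp ((z i)\<^sup>2 / 4))) \<partial>noise K n) = (\<Prod>i\<in>?I. ennreal (sqrt 2))"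
    unfolding noise_def by (subst product_nn_integral_prod) (auto simp: nn_integral_exp_square_std_normal)
  also have "\<dots> = ennreal (sqrt 2 ^ (K * n))" by (simp add: ennreal_power)
  finally have int: "(\<integral>\<^sup>+z. (\<Prod>i\<in>?I. ennreal (exp ((z i)\<^sup>2 / 4))) \<partial>noise K n) = \<dots>" .
  have A: "?A \<in> sets (noise K n)" by measurable
  have "ennreal (exp 1 ^ (K * n)) * emeasure (noise K n) ?A =
      (\<integral>\<^sup>+z. ennreal (exp 1 ^ (K * n)) * indicator ?A z \<partial>noise K n)"
    using A by (simp add: nn_integral_cmult_indicator)
  also have "\<dots> \<le> (\<integral>\<^sup>+z. (\<Prod>i\<in>?I. ennreal (exp ((z i)\<^sup>2 / 4))) \<partial>noise K n)"
  proof (intro nn_integral_mono)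
    fix z assume "z \<in> space (noise K n)"
    show "ennreal (exp 1 ^ (K * n)) * indicator ?A z \<le> (\<Prod>i\<in>?I. ennreal (exp ((z i)\<^sup>2 / 4)))"
    proof (cases "z \<in> ?A")
      case True
      have "exp 1 ^ (K * n) = exp (real (K * n))" by (simp flip: exp_of_nat_mult)
      also have "\<dots> \<le> exp (\<Sum>i\<in>?I. (z i)\<^sup>2 / 4)"
        using True by (simp flip: sum_divide_distrib)
      also have "\<dots> = (\<Prod>i\<in>?I. exp ((z i)\<^sup>2 / 4))" by (simp add: exp_sum)
      finally show ?thesis using True by (simp add: prod_ennreal ennreal_leI)
    qed simp
  qed
  also note int
  finally have le: "ennreal (exp 1 ^ (K * n)) * emeasure (noise K n) ?A \<le> ennreal (sqrt 2 ^ (K * n))" .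
  interpret N: prob_space "noise K n"
    unfolding noise_def by (intro prob_space_PiM P.prob_space_axioms)
  from le have "exp 1 ^ (K * n) * measure (noise K n) ?A \<le> sqrt 2 ^ (K * n)"
    by (simp add: N.emeasure_eq_measure flip: ennreal_mult)
  then show ?thesis by (simp add: power_divide field_simps)
qed

section \<open>Joint decoding\<close>

text \<open>\<open>Y j t\<close> and \<open>g w j t\<close> are the received and the noiseless output of Rx \<open>j\<close> at time \<open>t\<close>.\<close>

definition joint_dec ::
    "(nat \<Rightarrow> nat) set \<Rightarrow> (nat \<Rightarrow> nat set) \<Rightarrow> ((nat \<Rightarrow> nat) \<Rightarrow> nat \<Rightarrow> nat \<Rightarrow> real) \<Rightarrow> nat set
      \<Rightarrow> real \<Rightarrow> real \<Rightarrow> nat \<Rightarrow> (nat \<Rightarrow> nat \<Rightarrow> real) \<Rightarrow> nat" where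
  "joint_dec W seg g T r e k Y =
     (LEAST m. \<exists>w\<in>W. w k = m \<and>
        (\<Sum>t\<in>T. if \<exists>j\<in>seg t. r < \<bar>Y j t - g w j t\<bar> then 1 else 0) \<le> e)"

text \<open>If the true tuple \<open>w\<close> and a candidate \<open>w'\<close> both have at most
  \<open>e\<close> bad instants, then at every other instant the triangle inequality and
  \<open>rigid\<close> force equal symbols \<open>X\<close>. So the two words differ in at most
  \<open>2 * e\<close> places, and \<open>sep\<close> gives \<open>w' k = w k\<close>. The remaining
  components of the candidate may be wrong.\<close>

lemma joint_dec_correct:
  assumes "finite T" and "w \<in> W"
    and bad: "(\<Sum>t\<in>T. if \<exists>j\<in>seg t. r < \<bar>Y j t - g w j t\<bar> then 1 else 0) \<le> e"
    and sep: "\<And>w'. w' \<in> W \<Longrightarrow> w' k \<noteq> w k \<Longrightarrow> 2 * e < real (card {t \<in> T. X w t \<noteq> X w' t})"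
    and rigid: "\<And>w' t. w' \<in> W \<Longrightarrow> t \<in> T \<Longrightarrow>
      (\<And>j. j \<in> seg t \<Longrightarrow> \<bar>g w j t - g w' j t\<bar> \<le> 2 * r) \<Longrightarrow> X w t = X w' t"
  shows "joint_dec W seg g T r e k Y = w k"
  unfolding joint_dec_def
proof (rule Least_equality)
  show "\<exists>w'\<in>W. w' k = w k \<and> (\<Sum>t\<in>T. if \<exists>j\<in>seg t. r < \<bar>Y j t - g w' j t\<bar> then 1 else 0) \<le> e"
    using assms by blast
next
  fix m
  let ?bad = "\<lambda>w. {t \<in> T. \<exists>j\<in>seg t. r < \<bar>Y j t - g w j t\<bar>}"
  have card_bad: "(\<Sum>t\<in>T. if \<exists>j\<in>seg t. r < \<bar>Y j t - g w j t\<bar> then 1 else 0) = real (card (?bad w))" for w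
    using \<open>finite T\<close> by (simp add: sum.If_cases Int_def)
  assume "\<exists>w'\<in>W. w' k = m \<and> (\<Sum>t\<in>T. if \<exists>j\<in>seg t. r < \<bar>Y j t - g w' j t\<bar> then 1 else 0) \<le> e"
  then obtain w' where w': "w' \<in> W" "w' k = m"
    and bad': "(\<Sum>t\<in>T. if \<exists>j\<in>seg t. r < \<bar>Y j t - g w' j t\<bar> then 1 else 0) \<le> e" by blast
  have "X w t = X w' t" if t: "t \<in> T" "t \<notin> ?bad w" "t \<notin> ?bad w'" for t
  proof (rule rigid[OF w'(1) t(1)])
    fix j assume "j \<in> seg t"
    then have "\<bar>Y j t - g w j t\<bar> \<le> r" "\<bar>Y j t - g w' j t\<bar> \<le> r"
      using t by (auto simp: not_less)
    then show "\<bar>g w j t - g w' j t\<bar> \<le> 2 * r" by linarith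
  qed
  then have "{t \<in> T. X w t \<noteq> X w' t} \<subseteq> ?bad w \<union> ?bad w'" by blast
  then have "card {t \<in> T. X w t \<noteq> X w' t} \<le> card (?bad w \<union> ?bad w')"
    using \<open>finite T\<close> by (intro card_mono) auto
  also have "\<dots> \<le> card (?bad w) + card (?bad w')" by (rule card_Un_le)
  finally have "real (card {t \<in> T. X w t \<noteq> X w' t}) \<le> 2 * e"
    using bad bad' unfolding card_bad by linarith
  then show "w k \<le> m" using sep[OF w'(1)] w'(2) by fastforce
qed

lemma measurable_joint_dec:
  assumes "finite T" and "finite W" and "\<And>t. t \<in> T \<Longrightarrow> finite (seg t)"
    and Y: "\<And>t j. t \<in> T \<Longrightarrow> j \<in> seg t \<Longrightarrow> (\<lambda>\<omega>. Y \<omega> j t) \<in> borel_measurable M"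
  shows "(\<lambda>\<omega>. joint_dec W seg g T r e k (Y \<omega>)) \<in> M \<rightarrow>\<^sub>M count_space UNIV"
proof -
  have [measurable]: "Measurable.pred M (\<lambda>\<omega>. \<exists>j\<in>seg t. r < \<bar>Y \<omega> j t - g w j t\<bar>)" if "t \<in> T" for t w
  proof (intro pred_intros_finite)
    fix j assume "j \<in> seg t"
    note [measurable] = Y[OF that this]
    show "Measurable.pred M (\<lambda>\<omega>. r < \<bar>Y \<omega> j t - g w j t\<bar>)" by measurable
  qed (use assms that in auto)
  have [measurable]: "(\<lambda>\<omega>. \<Sum>t\<in>T. if \<exists>j\<in>seg t. r < \<bar>Y \<omega> j t - g w j t\<bar> then 1 else 0 :: real)
      \<in> borel_measurable M" for w
    by (intro borel_measurable_sum) measurable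
  show ?thesis
    unfolding joint_dec_def
    by (intro measurable_Least pred_intros_finite assms) measurable
qed


section \<open>Segments of transmitters\<close>

definition is_segment :: "nat set \<Rightarrow> nat \<Rightarrow> nat \<Rightarrow> bool" where
  "is_segment S a b \<longleftrightarrow> 1 \<le> a \<and> a \<le> b \<and> {a..b} \<subseteq> S \<and> a - 1 \<notin> S \<and> Suc b \<notin> S"

lemma segment_exists:
  assumes "finite S" and "0 \<notin> S" and "k \<in> S"
  obtains a b where "is_segment S a b" and "k \<in> {a..b}"
proof -
  define s where "s = Max {j. j < k \<and> j \<notin> S}"
  define a where "a = Suc s"
  define b where "b = (LEAST b. k \<le> b \<and> Suc b \<notin> S)"
  let ?J = "{j. j < k \<and> j \<notin> S}"
  have "0 \<in> ?J" using assms by (cases k) auto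
  then have "s \<in> ?J" unfolding s_def by (intro Max_in) auto
  moreover have "j \<in> S" if "s < j" "j \<le> k" for j
  proof (rule ccontr)
    assume "j \<notin> S"
    then have "j \<in> ?J" using that assms(3) by (cases "j = k") auto
    then have "j \<le> s" unfolding s_def by (intro Max_ge) auto
    with that show False by simp
  qed
  ultimately have a: "a \<le> k" "a - 1 \<notin> S" "{a..k} \<subseteq> S" by (auto simp: a_def)
  have "Suc (Max S) \<notin> S"
  proof
    assume "Suc (Max S) \<in> S"
    from Max_ge[OF assms(1) this] show False by simp
  qed
  then have "k \<le> Max S \<and> Suc (Max S) \<notin> S"
    using Max_ge[OF assms(1,3)] by blast
  then have "k \<le> b \<and> Suc b \<notin> S" unfolding b_def by (rule LeastI)
  moreover have "j \<in> S" if "k \<le> j" "j \<le> b" for j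
  proof (cases "j = k")
    case False
    then have "j - 1 < b" using that by simp
    then have "\<not> (k \<le> j - 1 \<and> Suc (j - 1) \<notin> S)"
      unfolding b_def by (rule not_less_Least)
    then show ?thesis using False that by simp
  qed (use assms in auto)
  ultimately have b: "k \<le> b" "Suc b \<notin> S" "{k..b} \<subseteq> S" by auto
  moreover have "{a..b} \<subseteq> {a..k} \<union> {k..b}" by auto
  ultimately have "is_segment S a b" "k \<in> {a..b}"
    using a by (auto simp: is_segment_def a_def)
  then show thesis by (rule that)
qed

text \<open>Interference from outside of the segment could only come from \<open>a - 1\<close> and
  \<open>Suc b\<close>, which do not transmit.\<close>

lemma noiseless_segment:
  assumes "is_segment S a b" and "S \<subseteq> {1..K}" and zero: "\<And>j. j \<notin> S \<Longrightarrow> x j = 0" and "k \<in> {a..b}"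
  shows "noiseless h {1..K} x k = noiseless h {a..b} x k"
proof -
  have *: "j = a - 1 \<or> j = Suc b" if "j \<in> nbrs {1..K} k - nbrs {a..b} k" for j
    using that assms(4) by (auto simp: nbrs_def)
  have "(\<Sum>j\<in>nbrs {1..K} k. h j k * x j) = (\<Sum>j\<in>nbrs {a..b} k. h j k * x j)"
  proof (intro sum.mono_neutral_right ballI)
    fix j assume "j \<in> nbrs {1..K} k - nbrs {a..b} k"
    then have "j \<notin> S" using * assms(1) by (auto simp: is_segment_def)
    then show "h j k * x j = 0" by (simp add: zero)
  qed (use assms in \<open>auto simp: nbrs_def is_segment_def\<close>)
  then show ?thesis by (simp add: noiseless_def)
qed

text \<open>\<open>s\<close> is the index just before the maximal run of \<open>E\<close> that
  contains \<open>k\<close>, so \<open>k - s\<close> is the position of \<open>k\<close> in this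
  run, counted from 1. If \<open>0 \<notin> E\<close>, index 0 takes the place of \<open>s\<close>
  for a run that starts at 1.\<close>

definition silenced :: "nat \<Rightarrow> nat set \<Rightarrow> nat \<Rightarrow> bool" where
  "silenced N E k \<longleftrightarrow> (\<exists>s. s \<notin> E \<and> s < k \<and> {s<..k} \<subseteq> E \<and> N dvd k - s)"

text \<open>Among \<open>N\<close> consecutive positions of a run one is a multiple of
  \<open>N\<close>. The interval need not be a maximal run, so positions are counted from an
  \<open>s\<close> that may lie further to the left than \<open>a - 1\<close>.\<close>

lemma silenced_in_long_run:
  assumes "1 \<le> a" and "0 \<notin> E" and "0 < N" and run: "{a..b} \<subseteq> E" and "a + N \<le> Suc b"
  shows "\<exists>k\<in>{a..b}. silenced N E k"
proof -
  let ?J = "{j. j < a \<and> j \<notin> E}"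
  define s where "s = Max ?J"
  have "0 \<in> ?J" using assms by auto
  then have "s \<in> ?J" unfolding s_def by (intro Max_in) auto
  then have s: "s < a" "s \<notin> E" by auto
  have "j \<in> E" if "s < j" "j \<le> b" for j
  proof (rule ccontr)
    assume "j \<notin> E"
    then have "j \<in> ?J" using that run by (auto simp: not_le[symmetric])
    then have "j \<le> s" unfolding s_def by (intro Max_ge) auto
    with that show False by simp
  qed
  then have *: "{s<..b} \<subseteq> E" by auto
  \<comment> \<open>The quotient is \<open>(a - s) / N\<close> rounded up, so \<open>k\<close> is
    the first multiple of \<open>N\<close>, counted from \<open>s\<close>, that is not below
    \<open>a\<close>.\<close>
  define k where "k = s + N * ((a - s + N - 1) div N)"
  have "N * ((a - s + N - 1) div N) + (a - s + N - 1) mod N = a - s + N - 1" by simp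
  moreover have "(a - s + N - 1) mod N < N" using assms by simp
  ultimately have "a \<le> k" "k \<le> a + N - 1"
    using s unfolding k_def by linarith+
  then have "k \<in> {a..b}" using assms by auto
  moreover have "silenced N E k"
    unfolding silenced_def
  proof (intro exI[of _ s] conjI)
    show "N dvd k - s" by (simp add: k_def)
  qed (use s * \<open>k \<in> {a..b}\<close> in auto)
  ultimately show ?thesis by blast
qed

text \<open>\<open>E\<close> stands for the eMBB users and \<open>V\<close> for the URLLC users
  scheduled in the phase. Silencing refers to runs of \<open>E\<close> and not of the remaining
  transmitters, hence does not depend on \<open>V\<close>.\<close>

definition tx_set :: "nat \<Rightarrow> nat set \<Rightarrow> nat set \<Rightarrow> nat set" where
  "tx_set N E V = {k \<in> E. \<not> silenced N E k \<and> k - 1 \<notin> V \<and> Suc k \<notin> V} \<union> V"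

text \<open>The neighbours of a user in \<open>V\<close> do not transmit, so a segment that meets
  \<open>V\<close> is a single user. Any other segment is a run of \<open>E\<close> without silenced
  users and is therefore shorter than \<open>N\<close>.\<close>

lemma tx_set_segment:
  assumes "finite E" and "finite V" and "0 \<notin> E" and "0 \<notin> V" and "E \<inter> V = {}"
    and V: "\<And>k. k \<in> V \<Longrightarrow> Suc k \<notin> V" and k: "k \<in> tx_set N E V" and "2 \<le> N"
  obtains a b where "is_segment (tx_set N E V) a b" and "k \<in> {a..b}" and "Suc b < a + N"
    and "k \<in> V \<Longrightarrow> a = b"
proof -
  have isolated: "Suc l \<notin> tx_set N E V" "l - 1 \<notin> tx_set N E V" if "l \<in> V" for l
    using that V[of l] V[of "l - 1"] assms(3,4) by (cases l; auto simp: tx_set_def)+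
  obtain a b where ab: "is_segment (tx_set N E V) a b" "k \<in> {a..b}"
    using assms by (auto intro: segment_exists[of "tx_set N E V" k] simp: tx_set_def)
  have single: "l = a \<and> l = b" if "l \<in> V" "l \<in> {a..b}" for l
  proof (rule ccontr)
    assume "\<not> (l = a \<and> l = b)"
    then have "l - 1 \<in> {a..b} \<or> Suc l \<in> {a..b}" using that by auto
    then show False using isolated[OF that(1)] ab by (auto simp: is_segment_def)
  qed
  have "Suc b < a + N"
  proof (cases "{a..b} \<inter> V = {}")
    case True
    have *: "l \<in> E \<and> \<not> silenced N E l" if "l \<in> {a..b}" for l
    proof -
      have "l \<in> tx_set N E V" "l \<notin> V" using that ab True by (auto simp: is_segment_def)
      then show ?thesis by (simp add: tx_set_def)
    qed
    show ?thesis
    proof (rule ccontr)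
      assume "\<not> Suc b < a + N"
      then have "\<exists>l\<in>{a..b}. silenced N E l"
        using assms ab * by (intro silenced_in_long_run) (auto simp: is_segment_def)
      with * show False by blast
    qed
  next
    case False
    then obtain l where "l \<in> V" "l \<in> {a..b}" by blast
    then show ?thesis using single[of l] \<open>2 \<le> N\<close> by simp
  qed
  then show thesis using that[OF ab] single ab by blast
qed


section \<open>Receiver cooperation\<close>

text \<open>Outputs live on \<open>{1..n}\<close>, cooperation messages are infinite sequences; the
  padding connects the two types of data.\<close>

definition extend :: "nat \<Rightarrow> (nat \<Rightarrow> real) \<Rightarrow> nat \<Rightarrow> real" where
  "extend n y = (\<lambda>t. if t \<in> {1..n} then y t else 0)"

text \<open>In the first round every Rx sends its own output, afterwards it passes on to either side
  what it received from the other side in the previous round. So in round \<open>i\<close>, Rx \<open>k\<close> obtains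
  the outputs of \<open>k + i\<close> and \<open>k - i\<close>.\<close>

definition forward ::
    "nat \<Rightarrow> nat \<Rightarrow> nat \<Rightarrow> nat \<Rightarrow> nat \<Rightarrow> activity \<Rightarrow> (nat \<Rightarrow> real) \<Rightarrow> history \<Rightarrow> coop_msg" where
  "forward n K j k l ab y r =
     (if j = 1 then extend n y
      else let i = (if l = Suc k then k - 1 else Suc k)
           in if i \<in> nbrs (K_active K ab) k then r (j - 1, i) else (\<lambda>_. 0))"

text \<open>The output of \<open>l\<close> reaches Rx \<open>k\<close> in round
  \<open>\<bar>l - k\<bar>\<close>, handed over by the neighbour of \<open>k\<close> on the side of
  \<open>l\<close>.\<close>

definition gather :: "nat \<Rightarrow> (nat \<Rightarrow> real) \<Rightarrow> history \<Rightarrow> nat \<Rightarrow> nat \<Rightarrow> real" where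
  "gather k y r l = (if l = k then y else if k < l then r (l - k, Suc k) else r (k - l, k - 1))"

text \<open>Induction over the rounds, for both directions at once. A message that arrives in the
  newest round \<open>Suc j\<close> was received in round \<open>j\<close> one hop closer to its
  source; older messages stay in the history. Only the users between source and destination have to
  be active.\<close>

lemma received_forward:
  assumes c: "coop c = forward n K" and "1 \<le> i" and "i \<le> j"
  shows "{k..k + i} \<subseteq> K_active K ab \<Longrightarrow> received K c ab y j k (i, Suc k) = extend n (y (k + i))"
    and "{k..k + i} \<subseteq> K_active K ab \<Longrightarrow> received K c ab y j (k + i) (i, k + i - 1) = extend n (y k)"
  using assms(2,3)
proof (induction j arbitrary: i k)
  case (Suc j)
  {
    case 1
    show ?case
    proof (cases "i = Suc j")
      case True
      have "Suc k \<in> nbrs (K_active K ab) k" using 1 by (auto simp: nbrs_def)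
      moreover have "Suc (Suc k) \<in> nbrs (K_active K ab) (Suc k)" if "j \<noteq> 0"
        using 1 True that by (auto simp: nbrs_def)
      moreover have "received K c ab y j (Suc k) (j, Suc (Suc k)) = extend n (y (Suc k + j))" if "j \<noteq> 0"
        using 1 True that by (intro Suc.IH) auto
      ultimately show ?thesis using True by (auto simp: c forward_def)
    next
      case False
      have "Suc k \<in> nbrs (K_active K ab) k" using 1 by (auto simp: nbrs_def)
      then show ?thesis using 1 False Suc.IH(1)[of k i] by auto
    qed
  next
    case 2
    have k: "0 < k" using 2 by (auto simp: K_active_def subset_iff dest: spec[of _ 0])
    have nb: "k + i - 1 \<in> nbrs (K_active K ab) (k + i)" using 2 by (auto simp: nbrs_def)
    show ?case
    proof (cases "i = Suc j")
      case True
      have "k + j - 1 \<in> nbrs (K_active K ab) (k + j)" if "j \<noteq> 0"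
      proof -
        have "k + j - 1 \<in> {k..k + i}" using True that by auto
        then have "k + j - 1 \<in> K_active K ab" using 2 by blast
        then show ?thesis by (simp add: nbrs_def)
      qed
      moreover have "received K c ab y j (k + j) (j, k + j - 1) = extend n (y k)" if "j \<noteq> 0"
        using 2 True that by (intro Suc.IH) auto
      ultimately show ?thesis using True nb by (auto simp: c forward_def)
    next
      case False
      then show ?thesis using 2 nb Suc.IH(2)[of k i] by auto
    qed
  }
qed simp_all

text \<open>Two users of a segment with \<open>b \<le> a + D\<close> are at distance at most
  \<open>D\<close>, so \<open>D\<close> rounds suffice.\<close>

lemma gather_received:
  assumes "coop c = forward n K" and "{a..b} \<subseteq> K_active K ab" and "k \<in> {a..b}" and "l \<in> {a..b}"
    and "b \<le> a + D" and "t \<in> {1..n}"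
  shows "gather k (y k) (received K c ab y D k) l t = y l t"
proof -
  consider "l = k" | "k < l" | "l < k" by linarith
  then show ?thesis
  proof cases
    case 2
    then have "received K c ab y D k (l - k, Suc k) = extend n (y (k + (l - k)))"
      using assms by (intro received_forward) auto
    then show ?thesis using 2 assms by (simp add: gather_def extend_def)
  next
    case 3
    then have "received K c ab y D (l + (k - l)) (k - l, l + (k - l) - 1) = extend n (y l)"
      using assms by (intro received_forward) auto
    then show ?thesis using 3 assms by (simp add: gather_def extend_def)
  qed (simp add: gather_def)
qed

section \<open>Measurability of forwarding and gathering\<close>

lemma measurable_extend [measurable]: "extend n \<in> output_space n \<rightarrow>\<^sub>M coop_msg_space"
  unfolding coop_msg_space_def extend_def
proof (rule measurable_PiM_single')
  fix t :: nat
  show "(\<lambda>y. if t \<in> {1..n} then y t else 0) \<in> borel_measurable (output_space n)"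
    unfolding output_space_def by (cases "t \<in> {1..n}") (simp_all only: if_True if_False, simp_all)
qed auto

lemma measurable_history_component:
  assumes "i \<in> {1..j}" and "l \<in> nbrs (K_active K ab) k"
  shows "(\<lambda>r. r (i, l)) \<in> history_space K ab j k \<rightarrow>\<^sub>M coop_msg_space"
  unfolding history_space_def using assms by (intro measurable_component_singleton) auto

lemma measurable_forward:
  assumes "j \<in> {1..D}"
  shows "(\<lambda>(y, r). forward n K j k l ab y r)
    \<in> output_space n \<Otimes>\<^sub>M history_space K ab (j - 1) k \<rightarrow>\<^sub>M coop_msg_space"
proof -
  define i where "i = (if l = Suc k then k - 1 else Suc k)"
  have "(\<lambda>_. 0) \<in> space coop_msg_space" by (auto simp: coop_msg_space_def space_PiM)
  moreover have "(\<lambda>x. snd x (j - 1, i))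
      \<in> output_space n \<Otimes>\<^sub>M history_space K ab (j - 1) k \<rightarrow>\<^sub>M coop_msg_space"
    if "j \<noteq> 1" "i \<in> nbrs (K_active K ab) k"
    using assms that
    by (intro measurable_compose[OF measurable_snd measurable_history_component]) auto
  ultimately show ?thesis
    unfolding forward_def Let_def split_beta i_def[symmetric]
    by (cases "j = 1"; cases "i \<in> nbrs (K_active K ab) k") auto
qed

lemma measurable_gather:
  assumes "{a..b} \<subseteq> K_active K ab" and "k \<in> {a..b}" and "l \<in> {a..b}"
    and "b \<le> a + D" and "t \<in> {1..n}"
  shows "(\<lambda>(y, r). gather k y r l t) \<in> borel_measurable (output_space n \<Otimes>\<^sub>M history_space K ab D k)"
proof -
  have comp: "(\<lambda>m. m t) \<in> borel_measurable coop_msg_space"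
    unfolding coop_msg_space_def by simp
  have y: "(\<lambda>y. y t) \<in> borel_measurable (output_space n)"
    unfolding output_space_def using assms by simp
  have r: "(\<lambda>x. snd x (i, j) t) \<in> borel_measurable (output_space n \<Otimes>\<^sub>M history_space K ab D k)"
    if "i \<in> {1..D}" "j \<in> nbrs (K_active K ab) k" for i j
    using that
    by (intro measurable_compose[OF measurable_compose[OF measurable_snd measurable_history_component] comp])
  consider "l = k" | "k < l" | "l < k" by linarith
  then show ?thesis
  proof cases
    case 1
    then show ?thesis using measurable_compose[OF measurable_fst y] by (simp add: gather_def case_prod_unfold)
  next
    case 2
    then have "Suc k \<in> nbrs (K_active K ab) k" using assms by (auto simp: nbrs_def)
    moreover have "l - k \<in> {1..D}" using 2 assms by auto
    ultimately show ?thesis using 2 r[of "l - k" "Suc k"] by (simp add: gather_def case_prod_unfold)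
  next
    case 3
    then have "k - 1 \<in> {a..b}" using assms by auto
    then have "k - 1 \<in> nbrs (K_active K ab) k" using assms(1) by (auto simp: nbrs_def)
    moreover have "k - l \<in> {1..D}" using 3 assms by auto
    ultimately show ?thesis using 3 r[of "k - l" "k - 1"] by (simp add: gather_def case_prod_unfold)
  qed
qed


section \<open>Existence of good codes\<close>

text \<open>Each bad instant absorbs noise energy of more than \<open>r\<^sup>2\<close>, and the
  total energy is below \<open>4 * K * n \<le> \<delta> * r\<^sup>2 * n\<close>.\<close>

lemma bad_times_le:
  assumes "0 < r" and r: "4 * real K \<le> \<delta> * r\<^sup>2"
    and z: "(\<Sum>i\<in>{1..K}\<times>{1..n}. (z i)\<^sup>2) < 4 * real (K * n)"
    and T: "T \<subseteq> {1..n}" and seg: "\<And>t. t \<in> T \<Longrightarrow> seg t \<subseteq> {1..K}"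
    and Y: "\<And>t j. t \<in> T \<Longrightarrow> j \<in> seg t \<Longrightarrow> Y j t - g j t = z (j, t)"
  shows "(\<Sum>t\<in>T. if \<exists>j\<in>seg t. r < \<bar>Y j t - g j t\<bar> then 1 else 0 :: real) \<le> \<delta> * real n"
proof -
  have "(\<Sum>t\<in>T. if \<exists>j\<in>seg t. r < \<bar>Y j t - g j t\<bar> then 1 else 0 :: real) * r\<^sup>2 =
      (\<Sum>t\<in>T. (if \<exists>j\<in>seg t. r < \<bar>Y j t - g j t\<bar> then 1 else 0) * r\<^sup>2)"
    by (rule sum_distrib_right)
  also have "\<dots> \<le> (\<Sum>t\<in>T. \<Sum>j\<in>{1..K}. (z (j, t))\<^sup>2)"
  proof (rule sum_mono)
    fix t assume t: "t \<in> T"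
    show "(if \<exists>j\<in>seg t. r < \<bar>Y j t - g j t\<bar> then 1 else 0) * r\<^sup>2 \<le> (\<Sum>j\<in>{1..K}. (z (j, t))\<^sup>2)"
    proof (cases "\<exists>j\<in>seg t. r < \<bar>Y j t - g j t\<bar>")
      case True
      then obtain j where j: "j \<in> seg t" "r < \<bar>Y j t - g j t\<bar>" by blast
      then have "r \<le> \<bar>z (j, t)\<bar>" using Y t by fastforce
      then have "r\<^sup>2 \<le> (z (j, t))\<^sup>2" using \<open>0 < r\<close> by (simp add: abs_le_square_iff[symmetric])
      also have "\<dots> \<le> (\<Sum>j\<in>{1..K}. (z (j, t))\<^sup>2)"
        using seg[OF t] j by (intro member_le_sum) auto
      finally show ?thesis using True by simp
    qed (simp add: sum_nonneg)
  qed
  also have "\<dots> \<le> (\<Sum>t\<in>{1..n}. \<Sum>j\<in>{1..K}. (z (j, t))\<^sup>2)"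
    using T by (intro sum_mono2) (auto intro: sum_nonneg)
  also have "\<dots> = (\<Sum>i\<in>{1..K}\<times>{1..n}. (z i)\<^sup>2)"
    by (subst sum.swap) (simp add: sum.cartesian_product)
  also have "\<dots> \<le> 4 * real K * real n" using z by simp
  also have "\<dots> \<le> (\<delta> * r\<^sup>2) * real n" using r by (intro mult_right_mono) auto
  finally have "(\<Sum>t\<in>T. if \<exists>j\<in>seg t. r < \<bar>Y j t - g j t\<bar> then 1 else 0 :: real) * r\<^sup>2 \<le>
      (\<delta> * real n) * r\<^sup>2" by (simp add: mult_ac)
  then show ?thesis using \<open>0 < r\<close> by simp
qed

text \<open>No integrability is assumed: the expectation of a nonintegrable function is 0 by
  convention, which \<open>0 \<le> B\<close> covers.\<close>

lemma expectation_pmf_le: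
  fixes f :: "'a \<Rightarrow> real"
  assumes "\<And>x. x \<in> set_pmf M \<Longrightarrow> f x \<le> B" and "0 \<le> B"
  shows "measure_pmf.expectation M f \<le> B"
proof (cases "integrable (measure_pmf M) f")
  case True
  then have "measure_pmf.expectation M f \<le> measure_pmf.expectation M (\<lambda>_. B)"
    using assms by (intro integral_mono_AE) (auto simp: AE_measure_pmf_iff)
  then show ?thesis by simp
qed (use assms in \<open>simp add: not_integrable_integral_eq\<close>)

text \<open>Whatever the activities and messages, decoding can fail only if the total noise energy
  reaches \<open>4 * K * n\<close>. \<open>S ab t\<close> is the set of transmitters at time
  \<open>t\<close>; user \<open>k\<close> sends a word of its codebook, spread over the times at
  which it transmits, with PAM spacing \<open>d\<close>.\<close>

lemma good_code_exists:
  fixes S :: "activity \<Rightarrow> nat \<Rightarrow> nat set" and Q s :: nat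
  assumes h: "\<And>a b x e k. 1 \<le> a \<Longrightarrow> b \<le> K \<Longrightarrow> Suc b \<le> a + (D + 1) \<Longrightarrow>
       (\<And>k. k \<in> {a..b} \<Longrightarrow> \<bar>noiseless h {a..b} x k\<bar> \<le> e) \<Longrightarrow> k \<in> {a..b} \<Longrightarrow> c0 * \<bar>x k\<bar> \<le> e"
    and c0: "c0 > 0" and r: "0 < r" "4 * real K \<le> \<delta> * r\<^sup>2" and d: "2 * r < c0 * d"
    and Q: "1 \<le> Q" "(d * (real Q - 1))\<^sup>2 \<le> P" and s: "s = nat \<lfloor>2 * \<delta> * real n\<rfloor>"
    and S: "\<And>ab t. S ab t \<subseteq> K_active K ab"
    and seg: "\<And>ab t k. k \<in> S ab t \<Longrightarrow>
      \<exists>a b. is_segment (S ab t) a b \<and> k \<in> {a..b} \<and> b \<le> a + D \<and> (k \<in> K_URLLC K ab \<longrightarrow> a = b)"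
    and count: "\<And>ab k. k \<in> K_active K ab \<Longrightarrow> num_msgs n (rate K RU Rs ab k) \<le> 1 \<or>
      num_msgs n (rate K RU Rs ab k) * (2 ^ card {t \<in> {1..n}. k \<in> S ab t} * Q ^ s)
        \<le> Q ^ card {t \<in> {1..n}. k \<in> S ab t}"
    and RU: "0 \<le> RU" and Rs: "\<And>k ab. 0 \<le> Rs k ab" and "1 \<le> n"
  shows "\<exists>c. valid_code D \<rho> \<rho>f P K n RU Rs c \<and>
    error_prob h D \<rho> \<rho>f K n RU Rs c \<le> (sqrt 2 / exp 1) ^ (K * n)"
proof -
  define T where "T = (\<lambda>ab k. {t \<in> {1..n}. k \<in> S ab t})"
  define M where "M = (\<lambda>ab k. num_msgs n (rate K RU Rs ab k))"
  have M1: "1 \<le> M ab k" for ab k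
    using RU Rs[of k ab] ge_one_powr_ge_zero[of 2 "real n * rate K RU Rs ab k"]
    by (simp add: M_def num_msgs_def rate_def le_nat_floor le_floor_iff Suc_le_eq)
  define book where "book = (\<lambda>ab k f. (\<forall>m t. f m t < Q) \<and>
    (\<forall>m\<in>{1..M ab k}. \<forall>m'\<in>{1..M ab k}. m \<noteq> m' \<longrightarrow> s < card {t \<in> T ab k. f m t \<noteq> f m' t}))"
  define cw where "cw = (\<lambda>ab k. SOME f. book ab k f)"
  have "book ab k (cw ab k)" if "k \<in> K_active K ab" for ab k
  proof -
    have "\<exists>f. book ab k f"
      unfolding book_def T_def M_def by (rule codebook_exists[OF _ Q(1) count[OF that]]) simp
    then show ?thesis unfolding cw_def by (rule someI_ex)
  qed
  then have cw: "(\<forall>m t. cw ab k m t < Q) \<and>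
      (\<forall>m\<in>{1..M ab k}. \<forall>m'\<in>{1..M ab k}. m \<noteq> m' \<longrightarrow>
        s < card {t \<in> T ab k. cw ab k m t \<noteq> cw ab k m' t})" if "k \<in> K_active K ab" for ab k
    using that by (simp add: book_def)
  \<comment> \<open>\<open>lo\<close> and \<open>hi\<close> are the ends of the segment of
    \<open>k\<close> at time \<open>t\<close>. They depend on \<open>ab\<close> and \<open>t\<close>
    only, so every Rx knows them.\<close>
  define lo where "lo = (\<lambda>ab t k. SOME a. \<exists>b. is_segment (S ab t) a b \<and> k \<in> {a..b} \<and> b \<le> a + D \<and>
    (k \<in> K_URLLC K ab \<longrightarrow> a = b))"
  define hi where "hi = (\<lambda>ab t k. SOME b. is_segment (S ab t) (lo ab t k) b \<and> k \<in> {lo ab t k..b} \<and>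
    b \<le> lo ab t k + D \<and> (k \<in> K_URLLC K ab \<longrightarrow> lo ab t k = b))"
  have lohi: "is_segment (S ab t) (lo ab t k) (hi ab t k) \<and> k \<in> {lo ab t k..hi ab t k} \<and>
    hi ab t k \<le> lo ab t k + D \<and> (k \<in> K_URLLC K ab \<longrightarrow> lo ab t k = hi ab t k)" if "k \<in> S ab t" for ab t k
  proof -
    have "\<exists>b. is_segment (S ab t) (lo ab t k) b \<and> k \<in> {lo ab t k..b} \<and>
        b \<le> lo ab t k + D \<and> (k \<in> K_URLLC K ab \<longrightarrow> lo ab t k = b)"
      unfolding lo_def using someI_ex[OF seg[OF that]] .
    from someI_ex[OF this] show ?thesis unfolding hi_def .
  qed
  define sg where "sg = (\<lambda>ab k t. {lo ab t k..hi ab t k})"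
  define X where "X = (\<lambda>ab w t k. if k \<in> S ab t then d * real (cw ab k (w k) t) else 0)"
  define g where "g = (\<lambda>ab w j t. noiseless h {1..K} (X ab w t) j)"
  \<comment> \<open>The support of the message distribution, with the default message 0 for inactive
    users.\<close>
  define W where "W = (\<lambda>ab. PiE_dflt (K_active K ab) 0 (\<lambda>k. {1..M ab k}))"
  define dec where "dec = (\<lambda>ab k. joint_dec (W ab) (sg ab k) (g ab) (T ab k) r (\<delta> * n) k)"
  \<comment> \<open>A URLLC user is always alone in its segment, so its decoder consults only its
    own output, passed as the constant function \<open>\<lambda>_. y\<close>.\<close>
  define c where "c = \<lparr>enc = \<lambda>k ab m t. if k \<in> S ab t then d * real (cw ab k m t) else 0,
    dec_URLLC = \<lambda>k ab y. dec ab k (\<lambda>_. y), coop = forward n K,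
    dec_eMBB = \<lambda>k ab y R. dec ab k (gather k y R)\<rparr>"
  have d0: "0 < d" using d r c0 by (smt (verit) mult_nonneg_nonpos)
  have P0: "0 \<le> P" using Q(2) by (smt (verit) zero_le_power2)
  have finact: "finite (K_active K ab)" for ab by (simp add: K_active_def)
  have finW: "finite (W ab)" for ab
    unfolding W_def by (intro finite_PiE_dflt finact) auto
  have finT: "finite (T ab k)" for ab k by (simp add: T_def)
  have SK: "S ab t \<subseteq> {1..K}" for ab t using S[of ab t] by (auto simp: K_active_def)
  have sg: "k \<in> sg ab k t" "sg ab k t \<subseteq> S ab t" "1 \<le> lo ab t k" "hi ab t k \<le> K"
    "sg ab k t \<subseteq> {1..K}" "sg ab k t \<subseteq> K_active K ab"
    if "t \<in> T ab k" for ab k t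
  proof -
    have k: "k \<in> S ab t" using that by (simp add: T_def)
    from lohi[OF this] show "k \<in> sg ab k t" "sg ab k t \<subseteq> S ab t" "1 \<le> lo ab t k"
      by (auto simp: sg_def is_segment_def)
    then show "sg ab k t \<subseteq> {1..K}" "sg ab k t \<subseteq> K_active K ab"
      using SK S by blast+
    moreover have "hi ab t k \<in> sg ab k t" using lohi[OF k] by (auto simp: sg_def)
    ultimately show "hi ab t k \<le> K" by auto
  qed
  have sg_URLLC: "sg ab k t = {k}" if "t \<in> T ab k" "k \<in> K_URLLC K ab" for ab k t
    using lohi[of k ab t] that by (auto simp: T_def sg_def)

  \<comment> \<open>Power constraint and measurability of the code\<close>
  have valid: "valid_code D \<rho> \<rho>f P K n RU Rs c"
    unfolding valid_code_def
  proof (intro ballI conjI)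
    fix ab k m assume k: "k \<in> K_active K ab"
    have "(enc c k ab m t)\<^sup>2 \<le> P" for t
    proof (cases "k \<in> S ab t")
      case True
      have "real (cw ab k m t) \<le> real Q - 1"
        using cw[OF k, THEN conjunct1, rule_format, of m t] by linarith
      then have "(d * real (cw ab k m t))\<^sup>2 \<le> (d * (real Q - 1))\<^sup>2"
        using d0 by (intro power_mono mult_left_mono) auto
      then show ?thesis using Q(2) True by (simp add: c_def)
    qed (use P0 in \<open>simp add: c_def\<close>)
    then have "(\<Sum>t=1..n. (enc c k ab m t)\<^sup>2) \<le> (\<Sum>t=1..n. P)" by (intro sum_mono)
    then show "1 / real n * (\<Sum>t=1..n. (enc c k ab m t)\<^sup>2) \<le> P"
      using \<open>1 \<le> n\<close> by (simp add: field_simps)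
  next
    fix ab k assume k: "k \<in> K_URLLC K ab"
    have "(\<lambda>y. joint_dec (W ab) (sg ab k) (g ab) (T ab k) r (\<delta> * n) k (\<lambda>_. y))
      \<in> output_space n \<rightarrow>\<^sub>M count_space UNIV"
      using finT finW
    proof (rule measurable_joint_dec)
      fix t j assume "t \<in> T ab k"
      then have "t \<in> {1..n}" by (simp add: T_def)
      then show "(\<lambda>y. y t) \<in> borel_measurable (output_space n)"
        unfolding output_space_def by simp
    qed (simp add: sg_def)
    then show "dec_URLLC c k ab \<in> output_space n \<rightarrow>\<^sub>M count_space UNIV"
      by (simp add: c_def dec_def)
  next
    fix ab j k l assume "j \<in> {1..D}"
    then show "(\<lambda>(y, r). coop c j k l ab y r)
        \<in> output_space n \<Otimes>\<^sub>M history_space K ab (j - 1) k \<rightarrow>\<^sub>M coop_msg_space"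
      using measurable_forward[of j D n K k l ab] by (simp add: c_def)
  next
    fix ab k
    have "(\<lambda>x. joint_dec (W ab) (sg ab k) (g ab) (T ab k) r (\<delta> * n) k (gather k (fst x) (snd x)))
        \<in> output_space n \<Otimes>\<^sub>M history_space K ab D k \<rightarrow>\<^sub>M count_space UNIV"
      using finT finW
    proof (rule measurable_joint_dec)
      fix t j assume t: "t \<in> T ab k" and j: "j \<in> sg ab k t"
      have "t \<in> {1..n}" "k \<in> S ab t" using t by (auto simp: T_def)
      then show "(\<lambda>x. gather k (fst x) (snd x) j t)
          \<in> borel_measurable (output_space n \<Otimes>\<^sub>M history_space K ab D k)"
        using measurable_gather[of "lo ab t k" "hi ab t k" K ab k j D t n] lohi[of k ab t] sg[OF t] j
        by (simp add: sg_def split_beta)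
    qed (simp add: sg_def)
    then show "(\<lambda>(y, R). dec_eMBB c k ab y R)
        \<in> output_space n \<Otimes>\<^sub>M history_space K ab D k \<rightarrow>\<^sub>M count_space UNIV"
      by (simp add: c_def dec_def split_beta)
  qed

  \<comment> \<open>From here on the argument is deterministic: every noise realisation of small
    energy is decoded correctly.\<close>
  have no_error: "\<not> decoding_error h D K n c ab w z"
    if w: "w \<in> W ab" and z: "(\<Sum>i\<in>{1..K}\<times>{1..n}. (z i)\<^sup>2) < 4 * real (K * n)" for ab w z
  proof -
    define y where "y = rx_output h K n c ab w z"
    have tx: "tx_input K c ab w t = X ab w t" for t
      using S[of ab t] by (intro ext) (auto simp: tx_input_def c_def X_def)
    have y: "y j t - g ab w j t = z (j, t)" if "t \<in> {1..n}" for j t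
      using that by (simp add: y_def rx_output_def tx g_def)
    have correct: "dec ab k Y = w k"
      if k: "k \<in> K_active K ab" and Y: "\<And>t j. t \<in> T ab k \<Longrightarrow> j \<in> sg ab k t \<Longrightarrow> Y j t = y j t" for k Y
      unfolding dec_def
    proof (rule joint_dec_correct[OF finT w, where X = "\<lambda>w t. cw ab k (w k) t"])
      show "(\<Sum>t\<in>T ab k. if \<exists>j\<in>sg ab k t. r < \<bar>Y j t - g ab w j t\<bar> then 1 else 0) \<le> \<delta> * real n"
      proof (rule bad_times_le[OF r z])
        fix t j assume t: "t \<in> T ab k" "j \<in> sg ab k t"
        then show "Y j t - g ab w j t = z (j, t)" using Y[OF t] y[of t j] by (simp add: T_def)
      qed (use sg in \<open>auto simp: T_def\<close>)
    next
      fix w' assume w': "w' \<in> W ab" and neq: "w' k \<noteq> w k"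
      have "w k \<in> {1..M ab k}" "w' k \<in> {1..M ab k}"
        using w w' k unfolding W_def PiE_dflt_def by auto
      then have "s < card {t \<in> T ab k. cw ab k (w k) t \<noteq> cw ab k (w' k) t}"
        by (rule cw[OF k, THEN conjunct2, rule_format]) (use neq in simp)
      \<comment> \<open>An integer that exceeds
        \<open>nat \<lfloor>2 * \<delta> * real n\<rfloor>\<close> also exceeds
        \<open>2 * \<delta> * real n\<close>.\<close>
      then show "2 * (\<delta> * real n) < real (card {t \<in> T ab k. cw ab k (w k) t \<noteq> cw ab k (w' k) t})"
        unfolding s by linarith
    next
      fix w' t assume w': "w' \<in> W ab" and t: "t \<in> T ab k"
        and close: "\<And>j. j \<in> sg ab k t \<Longrightarrow> \<bar>g ab w j t - g ab w' j t\<bar> \<le> 2 * r"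
      let ?a = "lo ab t k" and ?b = "hi ab t k"
      have kS: "k \<in> S ab t" using t by (simp add: T_def)
      note L = lohi[OF kS]
      \<comment> \<open>Outputs that agree up to \<open>2 * r\<close> on the whole segment force the
        inputs to agree up to \<open>2 * r / c0 < d\<close>. Inputs are multiples of
        \<open>d\<close>, so the symbols of \<open>k\<close> coincide.\<close>
      have "c0 * \<bar>X ab w t k - X ab w' t k\<bar> \<le> 2 * r"
      proof (rule h[of ?a ?b])
        fix j assume j: "j \<in> {?a..?b}"
        have *: "noiseless h {1..K} (X ab v t) j = noiseless h {?a..?b} (X ab v t) j" for v
          using L SK j by (intro noiseless_segment[of "S ab t"]) (auto simp: X_def)
        show "\<bar>noiseless h {?a..?b} (\<lambda>j. X ab w t j - X ab w' t j) j\<bar> \<le> 2 * r"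
          using close[of j] j by (simp only: noiseless_diff sg_def g_def * [symmetric])
      qed (use L sg[OF t] in auto)
      also have "\<dots> < c0 * d" by (rule d)
      finally have "\<bar>X ab w t k - X ab w' t k\<bar> < d" using c0 by simp
      moreover have "X ab w t k - X ab w' t k = d * (real (cw ab k (w k) t) - real (cw ab k (w' k) t))"
        using kS by (simp add: X_def right_diff_distrib)
      ultimately have "\<bar>real (cw ab k (w k) t) - real (cw ab k (w' k) t)\<bar> < 1"
        using d0 by (simp add: abs_mult)
      then show "cw ab k (w k) t = cw ab k (w' k) t" by linarith
    qed
    have "dec_URLLC c k ab (y k) = w k" if k: "k \<in> K_URLLC K ab" for k
      unfolding c_def code.simps
      using k sg_URLLC by (intro correct) (auto simp: K_URLLC_def K_active_def)
    moreover have "dec_eMBB c k ab (y k) (received K c ab y D k) = w k" if k: "k \<in> K_eMBB K ab" for k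
    proof -
      have "dec ab k (gather k (y k) (received K c ab y D k)) = w k"
      proof (rule correct)
        fix t j assume t: "t \<in> T ab k" and j: "j \<in> sg ab k t"
        then have "t \<in> {1..n}" "k \<in> S ab t" by (auto simp: T_def)
        then show "gather k (y k) (received K c ab y D k) j t = y j t"
          using lohi[of k ab t] sg[OF t] j
          by (intro gather_received[of c n K "lo ab t k" "hi ab t k"]) (auto simp: c_def sg_def)
      qed (use k in \<open>auto simp: K_eMBB_def\<close>)
      then show ?thesis by (simp add: c_def)
    qed
    ultimately show ?thesis
      unfolding decoding_error_def y_def[symmetric] Let_def by blast
  qed

  have "error_prob h D \<rho> \<rho>f K n RU Rs c \<le> (sqrt 2 / exp 1) ^ (K * n)"
    unfolding error_prob_def
  \<comment> \<open>The bound is uniform in \<open>ab\<close> and \<open>w\<close>, so it survives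
    both expectations.\<close>
  proof (intro expectation_pmf_le)
    fix ab w assume "w \<in> set_pmf (messages_pmf K n RU Rs ab)"
    also have "\<dots> = PiE_dflt (K_active K ab) 0 (\<lambda>k. set_pmf (pmf_of_set {1..M ab k}))"
      unfolding messages_pmf_def by (subst set_Pi_pmf[OF finact]) (simp add: o_def M_def)
    also have "\<dots> = W ab"
    proof -
      have "set_pmf (pmf_of_set {1..M ab k}) = {1..M ab k}" for k
        using M1[of ab k] by (intro set_pmf_of_set) auto
      then show ?thesis by (simp add: W_def)
    qed
    finally have w: "w \<in> W ab" .
    let ?B = "{z \<in> space (noise K n). 4 * real (K * n) \<le> (\<Sum>i\<in>{1..K}\<times>{1..n}. (z i)\<^sup>2)}"
    interpret N: prob_space "noise K n"
      unfolding noise_def by (intro prob_space_PiM prob_space_normal_density) simp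
    have ms[measurable]: "(\<lambda>z. z i) \<in> borel_measurable (noise K n)" if "i \<in> {1..K}\<times>{1..n}" for i
      using measurable_component_singleton[OF that, of "\<lambda>_. density lborel std_normal_density"]
      by (simp add: noise_def)
    have "{z \<in> space (noise K n). decoding_error h D K n c ab w z} \<subseteq> ?B"
      using no_error[OF w] by force
    moreover have "?B \<in> sets (noise K n)" by measurable
    ultimately have "measure (noise K n) {z \<in> space (noise K n). decoding_error h D K n c ab w z} \<le>
        measure (noise K n) ?B"
      by (rule N.finite_measure_mono)
    also have "\<dots> \<le> (sqrt 2 / exp 1) ^ (K * n)" by (rule noise_tail)
    finally show "measure (noise K n) {z \<in> space (noise K n). decoding_error h D K n c ab w z}
      \<le> (sqrt 2 / exp 1) ^ (K * n)" .
  qed simp_all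
  with valid show ?thesis by blast
qed


section \<open>Time sharing\<close>

definition URLLC_phase :: "nat \<Rightarrow> activity \<Rightarrow> nat \<Rightarrow> nat set" where
  "URLLC_phase K ab p = {k \<in> K_URLLC K ab. p \<noteq> 0 \<and> k mod 2 = p mod 2}"

definition phase_set :: "nat \<Rightarrow> nat \<Rightarrow> activity \<Rightarrow> nat \<Rightarrow> nat set" where
  "phase_set D K ab p = tx_set (D + 2) (K_eMBB K ab) (URLLC_phase K ab p)"

text \<open>\<open>l\<close> is the fraction of time that each of the phases \<open>1\<close> and \<open>2\<close> takes.\<close>

definition share :: "real \<Rightarrow> nat \<Rightarrow> nat \<Rightarrow> activity \<Rightarrow> nat \<Rightarrow> real" where
  "share l D K ab k = (1 - 2 * l) * of_bool (k \<in> phase_set D K ab 0) +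
     l * of_bool (k \<in> phase_set D K ab 1) + l * of_bool (k \<in> phase_set D K ab 2)"

definition phase :: "real \<Rightarrow> nat \<Rightarrow> nat \<Rightarrow> nat" where
  "phase l n t = (if t \<le> nat \<lfloor>l * n\<rfloor> then 1 else if t \<le> 2 * nat \<lfloor>l * n\<rfloor> then 2 else 0)"

lemma phase_set_subset: "phase_set D K ab p \<subseteq> K_active K ab"
  by (auto simp: phase_set_def tx_set_def URLLC_phase_def K_eMBB_def K_URLLC_def K_active_def)

text \<open>Adjacent users have different parity, so no two scheduled URLLC users are neighbours and
  \<open>tx_set_segment\<close> applies with \<open>N = D + 2\<close>. A URLLC user that transmits
  is a scheduled one, hence alone in its segment.\<close>

lemma phase_set_segment:
  assumes "k \<in> phase_set D K ab p"
  shows "\<exists>a b. is_segment (phase_set D K ab p) a b \<and> k \<in> {a..b} \<and> b \<le> a + D \<and>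
    (k \<in> K_URLLC K ab \<longrightarrow> a = b)"
proof -
  let ?E = "K_eMBB K ab" and ?V = "URLLC_phase K ab p"
  have "finite ?E" "finite ?V" "0 \<notin> ?E" "0 \<notin> ?V" "?E \<inter> ?V = {}"
    by (auto simp: K_eMBB_def K_active_def K_URLLC_def URLLC_phase_def)
  moreover have "Suc j \<notin> ?V" if "j \<in> ?V" for j
    using that by (auto simp: URLLC_phase_def) presburger
  ultimately obtain a b where "is_segment (phase_set D K ab p) a b" "k \<in> {a..b}" "Suc b < a + (D + 2)"
    and V: "k \<in> ?V \<Longrightarrow> a = b"
    using assms unfolding phase_set_def by (rule tx_set_segment) auto
  moreover have "k \<in> ?V" if "k \<in> K_URLLC K ab"
    using assms that by (auto simp: phase_set_def tx_set_def K_eMBB_def)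
  ultimately show ?thesis by (intro exI[of _ a] exI[of _ b]) auto
qed

text \<open>A URLLC user transmits in exactly one of the phases 1 and 2, according to its parity. So
  all URLLC users can have the same rate, as the model demands.\<close>

lemma share_URLLC:
  assumes "k \<in> K_URLLC K ab"
  shows "share l D K ab k = l"
proof -
  have "k \<in> phase_set D K ab p \<longleftrightarrow> p \<noteq> 0 \<and> k mod 2 = p mod 2" for p
    using assms by (auto simp: phase_set_def tx_set_def K_eMBB_def URLLC_phase_def)
  then show ?thesis by (cases "even k") (auto simp: share_def even_iff_mod_2_eq_zero odd_iff_mod_2_eq_one)
qed

text \<open>Rounding \<open>l * n\<close> down costs at most one instant in each of the phases 1 and
  2, while phase 0 can only gain.\<close>

lemma card_phase_set:
  assumes l: "0 \<le> l" "l \<le> 1 / 2"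
  shows "share l D K ab k * n - 2 \<le> card {t \<in> {1..n}. k \<in> phase_set D K ab (phase l n t)}"
proof -
  define L where "L = nat \<lfloor>l * n\<rfloor>"
  have L: "real L \<le> l * n" "l * n - 1 \<le> real L"
    using l unfolding L_def by (simp, linarith)
  have "l * n \<le> 1 / 2 * n" using l by (intro mult_right_mono) auto
  then have "2 * L \<le> n" using L by linarith
  define b where "b = (\<lambda>p. of_bool (k \<in> phase_set D K ab p) :: real)"
  have b: "0 \<le> b p" "b p \<le> 1" for p by (auto simp: b_def)
  have "real (card {t \<in> {1..n}. k \<in> phase_set D K ab (phase l n t)}) = (\<Sum>t\<in>{1..n}. b (phase l n t))"
    by (simp add: b_def of_bool_def sum.If_cases Int_def)
  also have "\<dots> = (\<Sum>t\<in>{1..L} \<union> ({L<..2 * L} \<union> {2 * L<..n}). b (phase l n t))"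
    using \<open>2 * L \<le> n\<close> by (intro sum.cong) auto
  also have "\<dots> =
      (\<Sum>t\<in>{1..L}. b (phase l n t)) + ((\<Sum>t\<in>{L<..2 * L}. b (phase l n t)) + (\<Sum>t\<in>{2 * L<..n}. b (phase l n t)))"
    by (subst sum.union_disjoint, simp, simp, force, subst sum.union_disjoint) auto
  also have "(\<Sum>t\<in>{1..L}. b (phase l n t)) = (\<Sum>t\<in>{1..L}. b 1)"
    by (intro sum.cong) (auto simp: phase_def L_def)
  also have "(\<Sum>t\<in>{L<..2 * L}. b (phase l n t)) = (\<Sum>t\<in>{L<..2 * L}. b 2)"
    by (intro sum.cong) (auto simp: phase_def L_def)
  also have "(\<Sum>t\<in>{2 * L<..n}. b (phase l n t)) = (\<Sum>t\<in>{2 * L<..n}. b 0)"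
    by (intro sum.cong) (auto simp: phase_def L_def)
  finally have card: "real (card {t \<in> {1..n}. k \<in> phase_set D K ab (phase l n t)}) =
      real L * b 1 + real L * b 2 + (real n - 2 * real L) * b 0"
    using \<open>2 * L \<le> n\<close> by (simp add: of_nat_diff)
  have "(l * n - 1) * b p \<le> real L * b p" for p using L b by (intro mult_right_mono) auto
  from this[of 1] this[of 2] have "(l * n) * b 1 - 1 \<le> real L * b 1" "(l * n) * b 2 - 1 \<le> real L * b 2"
    using b[of 1] b[of 2] by (simp_all add: left_diff_distrib)
  moreover have "(real n - 2 * (l * n)) * b 0 \<le> (real n - 2 * real L) * b 0"
    using L b by (intro mult_right_mono) auto
  moreover have "share l D K ab k * n = (l * n) * b 1 + (l * n) * b 2 + (real n - 2 * (l * n)) * b 0"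
    by (simp add: share_def b_def algebra_simps)
  ultimately show ?thesis unfolding card by linarith
qed

text \<open>The losses in the exponent account for the correction terms: the factor
  \<open>2 ^ m\<close> costs at most \<open>n\<close> bits, which is the \<open>- 1\<close>; the
  ball radius costs \<open>2 * \<delta> * n\<close> symbols and the two instants lost by rounding at
  most \<open>\<delta> * n\<close> more, together \<open>3 * \<delta>\<close>. If nothing remains,
  there is only one message.\<close>

lemma num_msgs_count:
  assumes R: "R \<le> max 0 ((w - 3 * \<delta>) * log 2 Q - 1)" and Q: "1 \<le> Q" and "0 < \<delta>" and n: "2 \<le> \<delta> * n"
    and card: "w * n - 2 \<le> real m" and "m \<le> n"
  shows "num_msgs n R \<le> 1 \<or> num_msgs n R * (2 ^ m * Q ^ nat \<lfloor>2 * \<delta> * n\<rfloor>) \<le> Q ^ m"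
proof (cases "(w - 3 * \<delta>) * log 2 Q - 1 \<le> 0")
  case True
  then have "R \<le> 0" using R by simp
  then have "real n * R \<le> 0" by (simp add: mult_nonneg_nonpos)
  then have "2 powr (real n * R) \<le> 2 powr 0" by (intro powr_mono) auto
  then have "num_msgs n R \<le> 1" unfolding num_msgs_def by (simp add: nat_le_iff floor_le_iff)
  then show ?thesis by simp
next
  case False
  define q where "q = log 2 Q"
  define s where "s = nat \<lfloor>2 * \<delta> * n\<rfloor>"
  have q: "0 \<le> q" "real Q = 2 powr q" using Q by (auto simp: q_def)
  have pow: "real Q ^ i = 2 powr (q * real i)" for i
    by (simp add: q(2) powr_realpow[symmetric] powr_powr)
  have s: "real s \<le> 2 * \<delta> * n" using \<open>0 < \<delta>\<close> by (simp add: s_def)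
  have "real n * R \<le> real n * ((w - 3 * \<delta>) * q - 1)"
    using R False by (intro mult_left_mono) (auto simp: q_def)
  also have "\<dots> = q * (w * n) - 3 * (q * (\<delta> * n)) - n" by (simp add: algebra_simps)
  finally have "real n * R \<le> \<dots>" .
  moreover have "q * real s \<le> q * (2 * (\<delta> * n))" using s q by (intro mult_left_mono) auto
  then have "q * real s \<le> 2 * (q * (\<delta> * n))" by simp
  moreover have "q * (w * n - 2) \<le> q * real m" using card q by (intro mult_left_mono) auto
  then have "q * (w * n) - 2 * q \<le> q * real m" by (simp add: right_diff_distrib)
  moreover have "q * 2 \<le> q * (\<delta> * n)" using n q by (intro mult_left_mono) auto
  ultimately have exponent: "real n * R + real m + q * real s \<le> q * real m"
    using \<open>m \<le> n\<close> by linarith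
  have "real (num_msgs n R) \<le> 2 powr (real n * R)"
    unfolding num_msgs_def by simp
  then have "real (num_msgs n R * (2 ^ m * Q ^ s)) \<le> 2 powr (real n * R) * (2 powr real m * 2 powr (q * real s))"
    by (simp add: pow powr_realpow mult_right_mono)
  also have "\<dots> = 2 powr (real n * R + real m + q * real s)" by (simp add: powr_add)
  also have "\<dots> \<le> 2 powr (q * real m)" using exponent by (intro powr_mono) auto
  also have "\<dots> = real (Q ^ m)" by (simp add: pow)
  finally show ?thesis unfolding s_def of_nat_le_iff by simp
qed

text \<open>A valid code is demanded for every blocklength, also for the small ones to which the
  construction does not apply.\<close>

lemma trivial_code_valid:
  assumes "0 \<le> P"
  shows "\<exists>c. valid_code D \<rho> \<rho>f P K n RU Rs c"
proof
  have 0: "(\<lambda>_. 0) \<in> space coop_msg_space" by (auto simp: coop_msg_space_def space_PiM)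
  show "valid_code D \<rho> \<rho>f P K n RU Rs \<lparr>enc = \<lambda>_ _ _ _. 0, dec_URLLC = \<lambda>_ _ _. 0,
      coop = \<lambda>_ _ _ _ _ _ _. 0, dec_eMBB = \<lambda>_ _ _ _. 0\<rparr>"
    using assms 0 by (auto simp: valid_code_def)
qed

lemma error_prob_nonneg: "0 \<le> error_prob h D \<rho> \<rho>f K n RU Rs c"
  unfolding error_prob_def by (intro integral_nonneg_AE AE_I2) simp

text \<open>\<open>C\<close> is the logarithm of the PAM spacing, which depends on \<open>K\<close>,
  \<delta> and the gains but not on \<open>P\<close>. So with power \<open>P\<close> each symbol
  carries at least \<open>L\<close> bits.\<close>

lemma achievable_pair:
  assumes ns: "nonsingular_runs h (D + 1)" and l: "0 \<le> l" "l \<le> 1 / 2" and \<delta>: "0 < \<delta>" and K: "1 \<le> K"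
  obtains C where "\<And>P RU Rbar L. 0 < P \<Longrightarrow> L = max 0 (1 / 2 * log 2 P - C) \<Longrightarrow>
    0 \<le> RU \<Longrightarrow> RU \<le> max 0 ((l - 3 * \<delta>) * L - 1) \<Longrightarrow> 0 \<le> Rbar \<Longrightarrow>
    Rbar \<le> measure_pmf.expectation (activity_pmf \<rho> \<rho>f K)
      (\<lambda>ab. 1 / real K * (\<Sum>k\<in>K_eMBB K ab. max 0 ((share l D K ab k - 3 * \<delta>) * L - 1))) \<Longrightarrow>
    achievable_rates h D \<rho> \<rho>f P K RU Rbar"
proof -
  obtain c0 where c0: "c0 > 0" and
    hc: "\<And>a b x e k. 1 \<le> a \<Longrightarrow> b \<le> K \<Longrightarrow> Suc b \<le> a + (D + 1) \<Longrightarrow>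
       (\<And>k. k \<in> {a..b} \<Longrightarrow> \<bar>noiseless h {a..b} x k\<bar> \<le> e) \<Longrightarrow> k \<in> {a..b} \<Longrightarrow> c0 * \<bar>x k\<bar> \<le> e"
    using nonsingular_runs_lower_bound[OF ns, of K] by blast
  \<comment> \<open>\<open>r\<close> is the least threshold with
    \<open>4 * K \<le> \<delta> * r\<^sup>2\<close>, and \<open>d\<close> is chosen so that
    \<open>c0 * d\<close> exceeds \<open>2 * r\<close>.\<close>
  define r where "r = sqrt (4 * real K / \<delta>)"
  define d where "d = 2 * r / c0 + 1"
  have r: "0 < r" "4 * real K \<le> \<delta> * r\<^sup>2" using K \<delta> by (simp_all add: r_def)
  have d: "2 * r < c0 * d" "0 < d" using c0 r by (simp_all add: d_def field_simps add_pos_pos)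
  show thesis
  proof (rule that[of "log 2 d"])
    fix P RU Rbar L :: real
    assume P: "0 < P" and L: "L = max 0 (1 / 2 * log 2 P - log 2 d)"
      and RU: "0 \<le> RU" "RU \<le> max 0 ((l - 3 * \<delta>) * L - 1)" and Rbar: "0 \<le> Rbar"
        "Rbar \<le> measure_pmf.expectation (activity_pmf \<rho> \<rho>f K)
          (\<lambda>ab. 1 / real K * (\<Sum>k\<in>K_eMBB K ab. max 0 ((share l D K ab k - 3 * \<delta>) * L - 1)))"
    \<comment> \<open>The number of multiples of \<open>d\<close> in the interval from 0 to
      \<open>sqrt P\<close>; it is at least 1 however small \<open>P\<close> is.\<close>
    define Q where "Q = nat \<lfloor>sqrt P / d\<rfloor> + 1"
    have "0 \<le> sqrt P / d" using P d by simp
    then have "real Q - 1 \<le> sqrt P / d" and Q: "sqrt P / d \<le> real Q" "1 \<le> Q"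
      unfolding Q_def by (simp, linarith, simp)
    then have "d * (real Q - 1) \<le> sqrt P" using d by (simp add: field_simps)
    moreover have "0 \<le> d * (real Q - 1)" using Q d by simp
    ultimately have "(d * (real Q - 1))\<^sup>2 \<le> (sqrt P)\<^sup>2" by (intro power_mono)
    then have power: "(d * (real Q - 1))\<^sup>2 \<le> P" using P by simp
    have "1 / 2 * log 2 P - log 2 d = log 2 (sqrt P / d)"
      using P d by (simp add: log_divide sqrt_def log_root)
    also have "\<dots> \<le> log 2 Q" using P d Q by (subst log_le_cancel_iff) auto
    finally have L_le: "L \<le> log 2 Q" using Q by (simp add: L)
    have L0: "0 \<le> L" by (simp add: L)
    have mono: "max 0 ((w - 3 * \<delta>) * L - 1) \<le> max 0 ((w - 3 * \<delta>) * log 2 Q - 1)" for w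
    proof (cases "0 \<le> w - 3 * \<delta>")
      case True
      then show ?thesis using mult_left_mono[OF L_le True] by auto
    next
      case False
      then have "(w - 3 * \<delta>) * L \<le> 0" using L0 by (simp add: mult_nonpos_nonneg)
      then show ?thesis by simp
    qed
    define Rs where "Rs = (\<lambda>k ab. max 0 ((share l D K ab k - 3 * \<delta>) * L - 1))"
    define S where "S = (\<lambda>n ab t. phase_set D K ab (phase l n t))"
    have rate: "rate K RU Rs ab k \<le> max 0 ((share l D K ab k - 3 * \<delta>) * log 2 Q - 1)" for ab k
    proof (cases "k \<in> K_URLLC K ab")
      case True
      then show ?thesis using RU(2) mono[of l] by (simp add: rate_def share_URLLC)
    qed (use mono in \<open>simp add: rate_def Rs_def\<close>)
    have good: "\<exists>c. valid_code D \<rho> \<rho>f P K n RU Rs c \<and>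
        error_prob h D \<rho> \<rho>f K n RU Rs c \<le> (sqrt 2 / exp 1) ^ (K * n)" if n: "1 \<le> n" "2 \<le> \<delta> * n" for n
    proof (rule good_code_exists[where S = "S n" and s = "nat \<lfloor>2 * \<delta> * real n\<rfloor>" and r = r and d = d
          and Q = Q and \<delta> = \<delta> and ?c0.0 = c0])
      show "c0 * \<bar>x k\<bar> \<le> e" if "1 \<le> a" "b \<le> K" "Suc b \<le> a + (D + 1)"
        "\<And>k. k \<in> {a..b} \<Longrightarrow> \<bar>noiseless h {a..b} x k\<bar> \<le> e" "k \<in> {a..b}" for a b x e k
        using that by (rule hc)
      show "S n ab t \<subseteq> K_active K ab" for ab t
        unfolding S_def by (rule phase_set_subset)
      show "\<exists>a b. is_segment (S n ab t) a b \<and> k \<in> {a..b} \<and> b \<le> a + D \<and> (k \<in> K_URLLC K ab \<longrightarrow> a = b)"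
        if "k \<in> S n ab t" for ab t k
        using that unfolding S_def by (rule phase_set_segment)
      show "num_msgs n (rate K RU Rs ab k) \<le> 1 \<or> num_msgs n (rate K RU Rs ab k) *
          (2 ^ card {t \<in> {1..n}. k \<in> S n ab t} * Q ^ nat \<lfloor>2 * \<delta> * real n\<rfloor>)
          \<le> Q ^ card {t \<in> {1..n}. k \<in> S n ab t}" for ab k
      proof (rule num_msgs_count[OF rate Q(2) \<delta> n(2)])
        show "share l D K ab k * n - 2 \<le> real (card {t \<in> {1..n}. k \<in> S n ab t})"
          unfolding S_def by (rule card_phase_set[OF l])
        show "card {t \<in> {1..n}. k \<in> S n ab t} \<le> n"
        proof -
          have "card {t \<in> {1..n}. k \<in> S n ab t} \<le> card {1..n}" by (intro card_mono) auto
          then show ?thesis by simp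
        qed
      qed
    qed (use RU n c0 r d(1) Q(2) power in \<open>auto simp: Rs_def\<close>)
    \<comment> \<open>Blocklengths with \<open>\<delta> * n < 2\<close> get the trivial code; they
      do not affect the limit.\<close>
    have "\<exists>c. valid_code D \<rho> \<rho>f P K n RU Rs c \<and>
        (1 \<le> n \<and> 2 \<le> \<delta> * n \<longrightarrow> error_prob h D \<rho> \<rho>f K n RU Rs c \<le> (sqrt 2 / exp 1) ^ (K * n))" for n
      using good[of n] trivial_code_valid[of P D \<rho> \<rho>f K n RU Rs] P by (cases "1 \<le> n \<and> 2 \<le> \<delta> * n") auto
    then obtain c where valid: "\<And>n. valid_code D \<rho> \<rho>f P K n RU Rs (c n)"
      and err: "\<And>n. 1 \<le> n \<Longrightarrow> 2 \<le> \<delta> * n \<Longrightarrow>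
        error_prob h D \<rho> \<rho>f K n RU Rs (c n) \<le> (sqrt 2 / exp 1) ^ (K * n)"
      by metis
    have "(\<lambda>n. error_prob h D \<rho> \<rho>f K n RU Rs (c n)) \<longlonglongrightarrow> 0"
    proof (rule tendsto_sandwich[OF _ _ tendsto_const])
      show "\<forall>\<^sub>F n in sequentially. error_prob h D \<rho> \<rho>f K n RU Rs (c n) \<le> ((sqrt 2 / exp 1) ^ K) ^ n"
        using eventually_ge_at_top[of "nat \<lceil>2 / \<delta>\<rceil>"] eventually_ge_at_top[of 1]
      proof eventually_elim
        case (elim n)
        have "2 / \<delta> \<le> real n" using elim by linarith
        then have "2 \<le> \<delta> * n" using \<delta> by (simp add: field_simps)
        then show ?case using err[of n] elim by (simp add: power_mult)
      qed
      have "sqrt 2 < 2" using real_sqrt_less_mono[of 2 4] by simp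
      moreover have "2 \<le> exp (1 :: real)" using exp_ge_add_one_self[of "1 :: real"] by simp
      ultimately have "sqrt 2 < exp (1 :: real)" by linarith
      then have "sqrt 2 / exp 1 < (1 :: real)" by simp
      then have "(sqrt 2 / exp 1) ^ K < (1 :: real)" using K by (intro power_less_one_iff[THEN iffD2]) auto
      then show "(\<lambda>n. ((sqrt 2 / exp 1) ^ K) ^ n) \<longlonglongrightarrow> (0 :: real)"
        by (intro LIMSEQ_power_zero) simp
    qed (simp add: error_prob_nonneg)
    then show "achievable_rates h D \<rho> \<rho>f P K RU Rbar"
      unfolding achievable_rates_def using RU Rbar valid
      by (intro conjI exI[of _ Rs] exI[of _ c]) (auto simp: Rs_def)
  qed
qed


section \<open>Expected multiplexing gain\<close>

text \<open>Limit of the mean share of the eMBB users, where \<open>y\<close> is the density of the silenced users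
  in phase \<open>0\<close>.\<close>

definition MG_share :: "real \<Rightarrow> nat \<Rightarrow> real \<Rightarrow> real \<Rightarrow> real" where
  "MG_share l N q u = (let y = (1 - q) * (q ^ N / (1 - q ^ N)) in
     (1 - l) * (q - y) + l * (1 - u) * ((1 - u) * q - y))"

lemma share_nonneg: "0 \<le> l \<Longrightarrow> l \<le> 1 / 2 \<Longrightarrow> 0 \<le> share l D K ab k"
  by (simp add: share_def)

text \<open>Both neighbours of \<open>k\<close> have the opposite parity, so they can disturb
  \<open>k\<close> only in one and the same of the phases 1 and 2. During the other phases, a
  fraction \<open>1 - l\<close> of the time, only silencing matters.\<close>

lemma share_eMBB:
  assumes "k \<in> K_eMBB K ab"
  shows "share l D K ab k = (1 - l) * of_bool (\<not> silenced (D + 2) (K_eMBB K ab) k) +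
    l * of_bool (\<not> silenced (D + 2) (K_eMBB K ab) k \<and> k - 1 \<notin> K_URLLC K ab \<and> Suc k \<notin> K_URLLC K ab)"
proof -
  have k: "1 \<le> k" "k \<notin> K_URLLC K ab" using assms by (auto simp: K_eMBB_def K_active_def)
  have mem: "k \<in> phase_set D K ab p \<longleftrightarrow> \<not> silenced (D + 2) (K_eMBB K ab) k \<and>
      k - 1 \<notin> URLLC_phase K ab p \<and> Suc k \<notin> URLLC_phase K ab p" for p
    using assms k by (auto simp: phase_set_def tx_set_def URLLC_phase_def)
  show ?thesis
  proof (cases "even k")
    case True
    then have "(k - 1) mod 2 = 1" "Suc k mod 2 = 1" using k by presburger+
    then show ?thesis by (simp add: share_def mem URLLC_phase_def algebra_simps)
  next
    case False
    then have "(k - 1) mod 2 = 0" "Suc k mod 2 = 0" using k by presburger+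
    then show ?thesis by (simp add: share_def mem URLLC_phase_def algebra_simps)
  qed
qed

lemma sum_power_multiples_le:
  fixes q :: real
  assumes "0 \<le> q" "q < 1" and "0 < N"
  shows "(\<Sum>m | m \<in> {1..k} \<and> N dvd m. q ^ m) \<le> q ^ N / (1 - q ^ N)"
proof -
  have qN: "q ^ N < 1" using assms by (intro power_less_one_iff[THEN iffD2]) auto
  have "{m. m \<in> {1..k} \<and> N dvd m} = (\<lambda>j. N * Suc j) ` {..<k div N}" (is "?L = ?R")
  proof (intro equalityI subsetI)
    fix m assume "m \<in> ?L"
    then obtain j where j: "m = N * j" "m \<le> k" "0 < j" by (auto simp: dvd_def)
    then have "j \<le> k div N" using assms by (simp add: less_eq_div_iff_mult_less_eq mult.commute)
    then show "m \<in> ?R" using j by (intro image_eqI[of _ _ "j - 1"]) auto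
  next
    fix m assume "m \<in> ?R"
    then obtain j where j: "m = N * Suc j" "j \<in> {..<k div N}" by (rule imageE)
    then have "Suc j \<le> k div N" by simp
    then have "m \<le> N * (k div N)" unfolding j(1) by (rule mult_le_mono2)
    also have "\<dots> \<le> k" by simp
    finally show "m \<in> ?L" using j assms by auto
  qed
  then have "(\<Sum>m | m \<in> {1..k} \<and> N dvd m. q ^ m) = (\<Sum>j<k div N. q ^ (N * Suc j))"
    using assms by (simp add: sum.reindex inj_on_def)
  also have "\<dots> = q ^ N * (\<Sum>j<k div N. (q ^ N) ^ j)"
    by (simp add: sum_distrib_left power_add power_mult)
  also have "(\<Sum>j<k div N. (q ^ N) ^ j) \<le> 1 / (1 - q ^ N)"
    using qN assms by (simp add: sum_gp_strict divide_right_mono)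
  finally show ?thesis using assms by (simp add: mult_left_mono)
qed

section \<open>Probabilities of activity events\<close>

context
  fixes \<rho> \<rho>f :: real
  assumes \<rho>: "0 \<le> \<rho>" "\<rho> \<le> 1" and \<rho>f: "0 \<le> \<rho>f" "\<rho>f \<le> 1"
begin

lemma finite_set_user_pmf: "finite (set_pmf (user_pmf \<rho> \<rho>f))"
  by (rule finite_subset[of _ UNIV]) auto

lemma finite_set_activity_pmf: "finite (set_pmf (activity_pmf \<rho> \<rho>f K))"
  unfolding activity_pmf_def
  by (rule finite_subset[OF set_Pi_pmf_subset']) (auto simp: finite_set_user_pmf)

lemma prob_user_eMBB: "measure_pmf.prob (user_pmf \<rho> \<rho>f) {(True, False)} = \<rho> * (1 - \<rho>f)"
  and prob_user_URLLC: "measure_pmf.prob (user_pmf \<rho> \<rho>f) {(True, True)} = \<rho> * \<rho>f"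
proof -
  have *: "pmf (map_pmf (Pair True) (bernoulli_pmf \<rho>f)) (True, b) = pmf (bernoulli_pmf \<rho>f) b" for b
    by (rule pmf_map_inj') (auto simp: inj_on_def)
  have **: "pmf (map_pmf (Pair False) (return_pmf False)) (True, b) = 0" for b
    by (simp add: pmf_return)
  show "measure_pmf.prob (user_pmf \<rho> \<rho>f) {(True, False)} = \<rho> * (1 - \<rho>f)"
    "measure_pmf.prob (user_pmf \<rho> \<rho>f) {(True, True)} = \<rho> * \<rho>f"
    unfolding measure_pmf_single user_pmf_def pmf_bind using \<rho> \<rho>f by (simp_all add: * **)
qed

lemma prob_activity:
  assumes "J \<subseteq> {1..K}"
  shows "measure_pmf.prob (activity_pmf \<rho> \<rho>f K) {ab. \<forall>k\<in>J. ab k \<in> B k} =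
    (\<Prod>k\<in>J. measure_pmf.prob (user_pmf \<rho> \<rho>f) (B k))"
proof -
  define B' where "B' = (\<lambda>k. if k \<in> J then B k else UNIV)"
  have "{ab. \<forall>k\<in>J. ab k \<in> B k} = Pi {1..K} B'"
    using assms by (auto simp: B'_def Pi_def)
  then have "measure_pmf.prob (activity_pmf \<rho> \<rho>f K) {ab. \<forall>k\<in>J. ab k \<in> B k} =
      (\<Prod>k\<in>{1..K}. measure_pmf.prob (user_pmf \<rho> \<rho>f) (B' k))"
    unfolding activity_pmf_def by (simp add: measure_Pi_pmf_Pi)
  also have "\<dots> = (\<Prod>k\<in>J. measure_pmf.prob (user_pmf \<rho> \<rho>f) (B' k))"
    using assms by (intro prod.mono_neutral_right) (auto simp: B'_def)
  finally show ?thesis by (simp add: B'_def)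
qed

text \<open>The conditions concern the disjoint positions \<open>s\<close>, \<open>{s<..k}\<close>
  and \<open>Suc k\<close>, hence the product. Index 0 is never an eMBB user, so for
  \<open>s = 0\<close> the first condition holds for free.\<close>

lemma prob_run:
  fixes K k s :: nat and C :: "(bool \<times> bool) set"
  defines "q \<equiv> \<rho> * (1 - \<rho>f)"
  assumes "s < k" and "k < K"
  shows "measure_pmf.prob (activity_pmf \<rho> \<rho>f K)
      {ab. s \<notin> K_eMBB K ab \<and> {s<..k} \<subseteq> K_eMBB K ab \<and> ab (Suc k) \<in> C} =
    (if s = 0 then 1 else 1 - q) * q ^ (k - s) * measure_pmf.prob (user_pmf \<rho> \<rho>f) C"
proof -
  let ?p = "measure_pmf.prob (user_pmf \<rho> \<rho>f)"
  define B where "B = (\<lambda>i. if i = s then - {(True, False)} else if i = Suc k then C else {(True, False)})"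
  let ?J = "{s..Suc k} - {0}"
  have eMBB: "i \<in> K_eMBB K ab \<longleftrightarrow> 1 \<le> i \<and> i \<le> K \<and> ab i = (True, False)" for i ab
    by (cases "ab i") (auto simp: K_eMBB_def K_active_def K_URLLC_def)
  have "{ab. s \<notin> K_eMBB K ab \<and> {s<..k} \<subseteq> K_eMBB K ab \<and> ab (Suc k) \<in> C} = {ab. \<forall>i\<in>?J. ab i \<in> B i}"
    (is "?L = ?R")
  proof (intro equalityI subsetI)
    fix ab assume ab: "ab \<in> ?L"
    have "ab i \<in> B i" if i: "i \<in> ?J" for i
    proof -
      consider "i = s" | "i = Suc k" | "i \<in> {s<..k}" using i by force
      then show ?thesis using ab i \<open>s < k\<close> \<open>k < K\<close> by cases (auto simp: B_def eMBB)
    qed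
    then show "ab \<in> ?R" by blast
  next
    fix ab assume ab: "ab \<in> ?R"
    then have mem: "ab i \<in> B i" if "i \<in> ?J" for i using that by blast
    have "ab (Suc k) \<in> C" using mem[of "Suc k"] \<open>s < k\<close> by (simp add: B_def)
    moreover have "ab i = (True, False)" if "i \<in> {s<..k}" for i
      using mem[of i] that by (simp add: B_def)
    moreover have "s \<notin> K_eMBB K ab"
      using mem[of s] \<open>s < k\<close> by (cases "s = 0") (simp_all add: B_def eMBB)
    ultimately show "ab \<in> ?L" using \<open>k < K\<close> by (auto simp: eMBB)
  qed
  also have "measure_pmf.prob (activity_pmf \<rho> \<rho>f K) \<dots> = (\<Prod>i\<in>?J. ?p (B i))"
    using \<open>k < K\<close> by (intro prob_activity) auto
  also have "?J = ({s} - {0}) \<union> ({s<..k} \<union> {Suc k})" using \<open>s < k\<close> by auto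
  also have "(\<Prod>i\<in>\<dots>. ?p (B i)) = (\<Prod>i\<in>{s} - {0}. ?p (B i)) * ((\<Prod>i\<in>{s<..k}. ?p (B i)) * ?p (B (Suc k)))"
    using \<open>s < k\<close> by (subst prod.union_disjoint, auto)+
  also have "(\<Prod>i\<in>{s<..k}. ?p (B i)) = (\<Prod>i\<in>{s<..k}. q)"
    by (intro prod.cong) (auto simp: B_def q_def prob_user_eMBB)
  also have "(\<Prod>i\<in>{s} - {0}. ?p (B i)) = (if s = 0 then 1 else 1 - q)"
    using measure_pmf.prob_compl[of "{(True, False)}" "user_pmf \<rho> \<rho>f"]
    by (simp add: B_def q_def prob_user_eMBB Compl_eq_Diff_UNIV)
  finally show ?thesis using \<open>s < k\<close> by (simp add: B_def mult.assoc)
qed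

text \<open>Union bound over the possible left ends \<open>s\<close>. Counting \<open>s = 0\<close>
  with the generic factor \<open>1 - q\<close> as well leaves an excess of at most
  \<open>q ^ k\<close>, which is the effect of the network boundary.\<close>

lemma prob_silenced_le:
  fixes K k N :: nat and C :: "(bool \<times> bool) set"
  defines "q \<equiv> \<rho> * (1 - \<rho>f)"
  assumes "q < 1" and "0 < N" and k: "1 \<le> k" "k < K"
  shows "measure_pmf.prob (activity_pmf \<rho> \<rho>f K) {ab. silenced N (K_eMBB K ab) k \<and> ab (Suc k) \<in> C} \<le>
    ((1 - q) * (q ^ N / (1 - q ^ N)) + q ^ k) * measure_pmf.prob (user_pmf \<rho> \<rho>f) C"
proof -
  let ?c = "measure_pmf.prob (user_pmf \<rho> \<rho>f) C"
  let ?P = "measure_pmf.prob (activity_pmf \<rho> \<rho>f K)"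
  let ?S = "{s. s < k \<and> N dvd k - s}"
  let ?ev = "\<lambda>s. {ab. s \<notin> K_eMBB K ab \<and> {s<..k} \<subseteq> K_eMBB K ab \<and> ab (Suc k) \<in> C}"
  have q0: "0 \<le> q" using \<rho> \<rho>f by (simp add: q_def)
  have "{ab. silenced N (K_eMBB K ab) k \<and> ab (Suc k) \<in> C} = (\<Union>s\<in>?S. ?ev s)"
    by (auto simp: silenced_def)
  then have "?P {ab. silenced N (K_eMBB K ab) k \<and> ab (Suc k) \<in> C} \<le> (\<Sum>s\<in>?S. ?P (?ev s))"
    by (simp add: measure_pmf.finite_measure_subadditive_finite)
  also have "\<dots> = (\<Sum>s\<in>?S. (if s = 0 then 1 else 1 - q) * q ^ (k - s) * ?c)"
    using k by (intro sum.cong) (auto simp: prob_run q_def)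
  also have "\<dots> \<le> (\<Sum>s\<in>?S. ((1 - q) * q ^ (k - s) + (if s = 0 then q ^ k else 0)) * ?c)"
    using q0 \<open>q < 1\<close> by (intro sum_mono mult_right_mono) (auto simp: algebra_simps mult_left_le_one_le)
  also have "\<dots> = ((1 - q) * (\<Sum>s\<in>?S. q ^ (k - s)) + (\<Sum>s\<in>?S. if s = 0 then q ^ k else 0)) * ?c"
    by (simp add: sum_distrib_right[symmetric] sum.distrib sum_distrib_left[symmetric])
  also have "(\<Sum>s\<in>?S. q ^ (k - s)) = (\<Sum>m | m \<in> {1..k} \<and> N dvd m. q ^ m)"
    by (rule sum.reindex_bij_witness[of _ "\<lambda>m. k - m" "\<lambda>s. k - s"]) auto
  also have "((1 - q) * \<dots> + (\<Sum>s\<in>?S. if s = 0 then q ^ k else 0)) * ?c \<le>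
      ((1 - q) * (q ^ N / (1 - q ^ N)) + q ^ k) * ?c"
    using q0 \<open>q < 1\<close> \<open>0 < N\<close>
    by (intro mult_right_mono add_mono mult_left_mono sum_power_multiples_le) auto
  finally show ?thesis .
qed

text \<open>Linearity of expectation over the users \<open>2, ..., K - 1\<close>, which have both
  neighbours. The two outer users are dropped, and the boundary errors \<open>q ^ k\<close> sum to
  at most \<open>1 / (1 - q)\<close>.\<close>

lemma expected_share:
  fixes D K :: nat and l :: real
  defines "q \<equiv> \<rho> * (1 - \<rho>f)" and "u \<equiv> \<rho> * \<rho>f"
  assumes q1: "q < 1" and l: "0 \<le> l" "l \<le> 1 / 2" and K: "2 \<le> K"
  shows "MG_share l (D + 2) q u * (real K - 2) / real K - 1 / (1 - q) / real K \<le>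
    measure_pmf.expectation (activity_pmf \<rho> \<rho>f K)
      (\<lambda>ab. 1 / real K * (\<Sum>k\<in>K_eMBB K ab. share l D K ab k))"
proof -
  let ?N = "D + 2"
  let ?E = "measure_pmf.expectation (activity_pmf \<rho> \<rho>f K)"
  let ?P = "measure_pmf.prob (activity_pmf \<rho> \<rho>f K)"
  \<comment> \<open>\<open>A\<close> and \<open>B\<close> are written as conditions on finitely many
    coordinates so that \<open>prob_activity\<close> applies. \<open>Z\<close> asks nothing of user
    \<open>k - 1\<close>: the left neighbour of a silenced user is an eMBB user anyway.\<close>
  define A where "A = (\<lambda>k. {ab :: activity. \<forall>i\<in>{k}. ab i \<in> {(True, False)}})"
  define B where "B = (\<lambda>k. {ab :: activity. \<forall>i\<in>{k - 1, k, Suc k}.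
    ab i \<in> (if i = k then {(True, False)} else - {(True, True)})})"
  define Z where "Z = (\<lambda>C k. {ab. silenced ?N (K_eMBB K ab) k \<and> ab (Suc k) \<in> C})"
  let ?U = "- {(True, True)} :: (bool \<times> bool) set"
  \<comment> \<open>"Not silenced" is expressed by subtracting silenced users. For \<open>k\<close>
    that is no eMBB user, \<open>f\<close> is at most 0, so it bounds the share from below in all
    cases.\<close>
  define f where "f = (\<lambda>ab k. (1 - l) * (indicat_real (A k) ab - indicat_real (Z UNIV k) ab) +
    l * (indicat_real (B k) ab - indicat_real (Z ?U k) ab))"
  define y where "y = (1 - q) * (q ^ ?N / (1 - q ^ ?N))"
  have q0: "0 \<le> q" and u0: "0 \<le> u" and u1: "u \<le> 1"
    using \<rho> \<rho>f by (auto simp: q_def u_def mult_le_one)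
  have int: "integrable (measure_pmf (activity_pmf \<rho> \<rho>f K)) g" for g :: "activity \<Rightarrow> real"
    by (rule integrable_measure_pmf_finite[OF finite_set_activity_pmf])
  have eMBB: "i \<in> K_eMBB K ab \<longleftrightarrow> 1 \<le> i \<and> i \<le> K \<and> ab i = (True, False)" for i ab
    by (cases "ab i") (auto simp: K_eMBB_def K_active_def K_URLLC_def)
  have URLLC: "i \<in> K_URLLC K ab \<longleftrightarrow> 1 \<le> i \<and> i \<le> K \<and> ab i = (True, True)" for i ab
    by (cases "ab i") (auto simp: K_URLLC_def)
  have pU: "measure_pmf.prob (user_pmf \<rho> \<rho>f) ?U = 1 - u"
    using measure_pmf.prob_compl[of "{(True, True)}" "user_pmf \<rho> \<rho>f"]
    by (simp add: u_def prob_user_URLLC Compl_eq_Diff_UNIV)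

  have pointwise: "(\<Sum>k\<in>{2..<K}. f ab k) \<le> (\<Sum>k\<in>K_eMBB K ab. share l D K ab k)" for ab
  proof -
    have "(\<Sum>k\<in>{2..<K}. f ab k) \<le> (\<Sum>k\<in>{2..<K}. if k \<in> K_eMBB K ab then share l D K ab k else 0)"
    proof (rule sum_mono)
      fix k assume k: "k \<in> {2..<K}"
      have sil: "k \<in> K_eMBB K ab" if "silenced ?N (K_eMBB K ab) k"
        using that by (auto simp: silenced_def)
      have ZU: "(1 - l) * indicat_real (Z UNIV k) ab = (1 - l) * of_bool (silenced ?N (K_eMBB K ab) k)"
        by (simp add: Z_def indicator_def)
      show "f ab k \<le> (if k \<in> K_eMBB K ab then share l D K ab k else 0)"
      proof (cases "k \<in> K_eMBB K ab")
        case True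
        have A: "indicat_real (A k) ab = 1" using True by (simp add: A_def eMBB)
        have B: "indicat_real (B k) ab = of_bool (k - 1 \<notin> K_URLLC K ab \<and> Suc k \<notin> K_URLLC K ab)"
          using True k by (auto simp: B_def eMBB URLLC indicator_def)
        have Z': "of_bool (silenced ?N (K_eMBB K ab) k \<and> k - 1 \<notin> K_URLLC K ab \<and> Suc k \<notin> K_URLLC K ab)
            \<le> indicat_real (Z ?U k) ab"
          using k by (auto simp: Z_def URLLC indicator_def)
        have "f ab k \<le> (1 - l) * (1 - of_bool (silenced ?N (K_eMBB K ab) k)) +
            l * (of_bool (k - 1 \<notin> K_URLLC K ab \<and> Suc k \<notin> K_URLLC K ab) -
              of_bool (silenced ?N (K_eMBB K ab) k \<and> k - 1 \<notin> K_URLLC K ab \<and> Suc k \<notin> K_URLLC K ab))"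
          unfolding f_def A B right_diff_distrib ZU using mult_left_mono[OF Z' l(1)] by simp
        also have "\<dots> = share l D K ab k"
          unfolding share_eMBB[OF True] by (auto simp: of_bool_def)
        finally show ?thesis using True by simp
      next
        case False
        then have "ab k \<noteq> (True, False)" using k by (auto simp: eMBB)
        then have "indicat_real (A k) ab = 0" "indicat_real (B k) ab = 0" by (auto simp: A_def B_def)
        moreover have "0 \<le> (1 - l) * indicat_real (Z UNIV k) ab" "0 \<le> l * indicat_real (Z ?U k) ab"
          using l by simp_all
        ultimately show ?thesis using False by (simp add: f_def)
      qed
    qed
    also have "\<dots> = (\<Sum>k\<in>{2..<K} \<inter> K_eMBB K ab. share l D K ab k)"
      by (simp add: sum.inter_restrict)
    also have "\<dots> \<le> (\<Sum>k\<in>K_eMBB K ab. share l D K ab k)"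
      using l by (intro sum_mono2) (auto intro: share_nonneg simp: K_eMBB_def K_active_def)
    finally show ?thesis .
  qed

  have Ef: "MG_share l ?N q u - q ^ k \<le> ?E (\<lambda>ab. f ab k)" if k: "k \<in> {2..<K}" for k
  proof -
    have "?E (\<lambda>ab. f ab k) = (1 - l) * (?P (A k) - ?P (Z UNIV k)) + l * (?P (B k) - ?P (Z ?U k))"
      unfolding f_def by (simp add: int)
    moreover have "?P (A k) = q"
      unfolding A_def using k by (subst prob_activity) (auto simp: prob_user_eMBB q_def)
    moreover have "?P (B k) = (1 - u) * (1 - u) * q"
    proof -
      obtain j where j: "k = Suc j" "1 \<le> j" using k by (cases k) auto
      show ?thesis
        unfolding B_def j(1) using k j
        by (subst prob_activity) (auto simp: pU prob_user_eMBB q_def)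
    qed
    moreover have "?P (Z UNIV k) \<le> y + q ^ k"
      using prob_silenced_le[of ?N k K UNIV] k q1 by (simp add: Z_def y_def q_def)
    then have "(1 - l) * ?P (Z UNIV k) \<le> (1 - l) * (y + q ^ k)"
      using l by (intro mult_left_mono) auto
    moreover have "?P (Z ?U k) \<le> (y + q ^ k) * (1 - u)"
      using prob_silenced_le[of ?N k K ?U] k q1 by (simp add: Z_def y_def q_def pU)
    then have "l * ?P (Z ?U k) \<le> l * ((y + q ^ k) * (1 - u))"
      using l by (intro mult_left_mono) auto
    \<comment> \<open>The boundary errors add up to \<open>(1 - l) * q ^ k + l * (1 - u) * q ^ k = q
      ^ k - l * u * q ^ k\<close>.\<close>
    moreover have "0 \<le> l * u * q ^ k" using l u0 q0 by simp
    ultimately show ?thesis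
      unfolding MG_share_def Let_def y_def[symmetric] by (simp add: algebra_simps)
  qed
  have "(\<Sum>k\<in>{2..<K}. q ^ k) \<le> (\<Sum>k<K. q ^ k)"
    using q0 by (intro sum_mono2) auto
  also have "\<dots> \<le> 1 / (1 - q)"
    using q0 q1 by (simp add: sum_gp_strict divide_right_mono)
  finally have geo: "(\<Sum>k\<in>{2..<K}. q ^ k) \<le> 1 / (1 - q)" .
  have "MG_share l ?N q u * (real K - 2) - 1 / (1 - q) \<le> (\<Sum>k\<in>{2..<K}. MG_share l ?N q u - q ^ k)"
    using geo K by (simp add: sum_subtractf of_nat_diff algebra_simps)
  also have "\<dots> \<le> (\<Sum>k\<in>{2..<K}. ?E (\<lambda>ab. f ab k))" by (intro sum_mono Ef)
  also have "\<dots> = ?E (\<lambda>ab. \<Sum>k\<in>{2..<K}. f ab k)" by (simp add: int)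
  also have "\<dots> \<le> ?E (\<lambda>ab. \<Sum>k\<in>K_eMBB K ab. share l D K ab k)"
    by (intro integral_mono int pointwise)
  finally have "(MG_share l ?N q u * (real K - 2) - 1 / (1 - q)) * (1 / real K) \<le>
      ?E (\<lambda>ab. \<Sum>k\<in>K_eMBB K ab. share l D K ab k) * (1 / real K)"
    by (intro mult_right_mono) auto
  then show ?thesis by (simp add: diff_divide_distrib mult.commute)
qed

end


section \<open>Comparison with the claimed bound\<close>

text \<open>The left-hand side decreases in \<open>N\<close>, and for \<open>N = 4\<close> the
  factor \<open>1 - q\<close> cancels from the denominator.\<close>

lemma silenced_rate_le:
  fixes q :: real
  assumes q: "0 \<le> q" "q < 1" and "4 \<le> N"
  shows "(1 - q) * (q ^ N / (1 - q ^ N)) \<le> q\<^sup>2 / 4"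
proof -
  have q4: "q ^ N \<le> q ^ 4" "q ^ 4 < 1"
    using assms by (auto intro: power_decreasing power_less_one_iff[THEN iffD2])
  have "q ^ N / (1 - q ^ N) \<le> q ^ 4 / (1 - q ^ 4)"
    using q q4 by (intro frac_le) auto
  then have "(1 - q) * (q ^ N / (1 - q ^ N)) \<le> (1 - q) * (q ^ 4 / (1 - q ^ 4))"
    using q by (intro mult_left_mono) auto
  also have "1 - q ^ 4 = (1 - q) * ((1 + q) * (1 + q\<^sup>2))" by (simp add: algebra_simps power2_eq_square power4_eq_xxxx)
  also have "(1 - q) * (q ^ 4 / ((1 - q) * ((1 + q) * (1 + q\<^sup>2)))) = q ^ 4 / ((1 + q) * (1 + q\<^sup>2))"
    using q by simp
  also have "\<dots> \<le> q\<^sup>2 / 4"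
  proof -
    \<comment> \<open>The product is \<open>(1 + q) * (1 + q\<^sup>2) - 4 * q\<^sup>2\<close> in
      factored form.\<close>
    have "0 \<le> (1 - q) * (1 + q * (2 - q))" using q by (intro mult_nonneg_nonneg add_nonneg_nonneg) auto
    then have "4 * q\<^sup>2 \<le> (1 + q) * (1 + q\<^sup>2)" by (simp add: algebra_simps power2_eq_square)
    then have "q\<^sup>2 * (4 * q\<^sup>2) \<le> q\<^sup>2 * ((1 + q) * (1 + q\<^sup>2))" by (intro mult_left_mono) auto
    moreover have "0 < (1 + q) * (1 + q\<^sup>2)" using q by (intro mult_pos_pos add_pos_nonneg) auto
    ultimately show ?thesis by (simp add: field_simps power2_eq_square power4_eq_xxxx)
  qed
  finally show ?thesis .
qed

lemma eMBB_bound_eq: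
  "eMBB_bound D \<rho> \<rho>f = \<rho> * (1 - \<rho>f) - (1 - \<rho> * (1 - \<rho>f)) *
     ((\<rho> * (1 - \<rho>f)) ^ (D + 2) / (1 - (\<rho> * (1 - \<rho>f)) ^ (D + 2)))"
  unfolding eMBB_bound_def power_mult_distrib by simp

text \<open>With \<open>SU = u * l\<close> only the product \<open>u * slope_M\<close> enters the
  bound. It is an expression in \<open>q\<close>, \<open>u\<close> and \<open>x\<close>, free of the
  denominator \<rho>f.\<close>

lemma slope_M_eq:
  fixes \<rho> \<rho>f :: real and D :: nat
  defines "q \<equiv> \<rho> * (1 - \<rho>f)" and "u \<equiv> \<rho> * \<rho>f"
  defines "x \<equiv> q ^ (D + 2) / (1 - q ^ (D + 2))"
  assumes "\<rho> \<noteq> 0" and "\<rho>f \<noteq> 0"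
  shows "u * slope_M D \<rho> \<rho>f = 2 * q - 2 * ((1 - q) * x) + u\<^sup>2 / (1 - q\<^sup>2) * (2 * q\<^sup>2 / (1 - q\<^sup>2) - x)
     - ((1 - q)\<^sup>2 + (1 - q - u)\<^sup>2) / (1 - q) * (q / (1 - q) - x)"
proof -
  define X where "X = 1 - q ^ (D + 2)"
  have X: "1 - \<rho> ^ (D + 2) * (1 - \<rho>f) ^ (D + 2) = X" by (simp add: X_def q_def power_mult_distrib)
  have i: "1 - \<rho> = 1 - q - u" by (simp add: q_def u_def algebra_simps)
  have q2: "\<rho>\<^sup>2 * (1 - \<rho>f)\<^sup>2 = q\<^sup>2" by (simp add: q_def power_mult_distrib)
  have t1: "u * (2 * (1 - \<rho>f) / \<rho>f) = 2 * q"
    using assms by (simp add: q_def u_def)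
  have t2: "u * (2 * (1 - q) * \<rho> ^ (D + 1) * (1 - \<rho>f) ^ (D + 2) / (\<rho>f * X)) = 2 * ((1 - q) * x)"
  proof -
    have "\<rho> * (\<rho> ^ (D + 1) * (1 - \<rho>f) ^ (D + 2)) = q ^ (D + 2)" by (simp add: q_def power_mult_distrib)
    then have "x = \<rho> * (\<rho> ^ (D + 1) * (1 - \<rho>f) ^ (D + 2)) / X" by (simp add: x_def X_def)
    then show ?thesis using assms by (simp add: u_def)
  qed
  have t3: "u * (\<rho> ^ 3 * \<rho>f * (1 - \<rho>f)\<^sup>2 / (1 - q\<^sup>2) * (2 / (1 - q\<^sup>2) - \<rho> ^ D * (1 - \<rho>f) ^ D / X)) =
      u\<^sup>2 / (1 - q\<^sup>2) * (2 * q\<^sup>2 / (1 - q\<^sup>2) - x)"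
  proof -
    have "\<rho> ^ 3 * \<rho>f * (1 - \<rho>f)\<^sup>2 = u * q\<^sup>2"
      by (simp add: q_def u_def power_mult_distrib power2_eq_square power3_eq_cube)
    moreover have "x = q\<^sup>2 * (\<rho> ^ D * (1 - \<rho>f) ^ D / X)"
      by (simp add: x_def X_def q_def power_mult_distrib power_add power2_eq_square)
    ultimately show ?thesis by (simp add: power2_eq_square right_diff_distrib mult_ac)
  qed
  have t4: "u * ((1 - \<rho>f) * c / (\<rho>f * (1 - q)) * (1 / (1 - q) - \<rho> ^ (D + 1) * (1 - \<rho>f) ^ (D + 1) / X)) =
      c / (1 - q) * (q / (1 - q) - x)" for c
  proof -
    define A where "A = \<rho> ^ (D + 1) * (1 - \<rho>f) ^ (D + 1) / X"
    have "x = q * A"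
      by (simp add: x_def X_def q_def A_def power_mult_distrib)
    moreover have "u * ((1 - \<rho>f) * c / (\<rho>f * (1 - q))) = q * (c / (1 - q))"
      using assms by (simp add: q_def u_def)
    moreover have "q * b * (1 / r - A) = b * (q / r - q * A)" for b r
      by (simp add: algebra_simps)
    ultimately show ?thesis unfolding A_def[symmetric] mult.assoc[symmetric, of u] by simp
  qed
  have "u * (a - b + c - d) = u * a - u * b + u * c - u * d" for a b c d
    by (simp add: algebra_simps)
  then show ?thesis
    unfolding slope_M_def q_def[symmetric] X q2 i by (simp only: t1 t2 t3 t4)
qed

lemma eMBB_bound_le_MG_share:
  fixes \<rho> \<rho>f l :: real and D :: nat
  defines "q \<equiv> \<rho> * (1 - \<rho>f)" and "u \<equiv> \<rho> * \<rho>f"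
  assumes D: "2 \<le> D" and \<rho>: "0 < \<rho>" "\<rho> < 1" and \<rho>f: "0 < \<rho>f" "\<rho>f \<le> 1" and l: "0 \<le> l"
  shows "eMBB_bound D \<rho> \<rho>f - slope_M D \<rho> \<rho>f * (u * l) \<le> MG_share l (D + 2) q u"
proof -
  define x where "x = q ^ (D + 2) / (1 - q ^ (D + 2))"
  define y where "y = (1 - q) * x"
  \<comment> \<open>\<open>v\<close> rescales the range from 0 to \<open>1 - q\<close> of
    \<open>u\<close> to the unit interval; \<open>u < 1 - q\<close> follows from
    \<open>\<rho> < 1\<close>.\<close>
  define v where "v = u / (1 - q)"
  define b where "b = q - y"
  have q0: "0 \<le> q" using \<rho> \<rho>f by (simp add: q_def)
  have qu: "q + u < 1" using \<rho> by (simp add: q_def u_def algebra_simps)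
  have u0: "0 < u" using \<rho> \<rho>f by (simp add: u_def)
  have q1: "q < 1" using qu u0 by linarith
  have v: "0 \<le> v" "v \<le> 1" "u = v * (1 - q)" using u0 q1 qu by (simp_all add: v_def)
  have y: "y \<le> q\<^sup>2 / 4" unfolding y_def x_def using q0 q1 D by (intro silenced_rate_le) auto
  have bound: "eMBB_bound D \<rho> \<rho>f = b"
    by (simp add: eMBB_bound_eq b_def y_def x_def q_def)
  have share: "MG_share l (D + 2) q u = b - l * (b - (1 - u) * (b - u * q))"
    unfolding MG_share_def Let_def x_def[symmetric] y_def[symmetric] b_def by (simp add: algebra_simps)
  have "u * slope_M D \<rho> \<rho>f = 2 * q - 2 * y + u\<^sup>2 / (1 - q\<^sup>2) * (2 * q\<^sup>2 / (1 - q\<^sup>2) - x)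
     - ((1 - q)\<^sup>2 + (1 - q - u)\<^sup>2) / (1 - q) * (q / (1 - q) - x)"
    using slope_M_eq[of \<rho> \<rho>f D] \<rho> \<rho>f by (simp add: q_def u_def x_def y_def)
  also have "((1 - q)\<^sup>2 + (1 - q - u)\<^sup>2) / (1 - q) * (q / (1 - q) - x) = (1 + (1 - v)\<^sup>2) * b"
  proof -
    have "1 - q - u = (1 - q) * (1 - v)" by (simp add: v(3) algebra_simps)
    then have "(1 - q)\<^sup>2 + (1 - q - u)\<^sup>2 = (1 - q) * ((1 - q) * (1 + (1 - v)\<^sup>2))"
      by (simp add: power_mult_distrib power2_eq_square distrib_left mult.assoc)
    moreover have "(1 - q) * (q / (1 - q) - x) = b" using q1 by (simp add: b_def y_def right_diff_distrib)
    ultimately show ?thesis using q1 by simp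
  qed
  also have "u\<^sup>2 / (1 - q\<^sup>2) * (2 * q\<^sup>2 / (1 - q\<^sup>2) - x) = v\<^sup>2 * (2 * q\<^sup>2 / (1 + q)\<^sup>2 - y / (1 + q))"
  proof -
    have "1 - q\<^sup>2 = (1 - q) * (1 + q)" by (simp add: power2_eq_square algebra_simps)
    moreover have "(v * r)\<^sup>2 / (r * t) * (2 * q\<^sup>2 / (r * t) - x) = v\<^sup>2 * (2 * q\<^sup>2 / t\<^sup>2 - r * x / t)"
      if "r \<noteq> 0" "t \<noteq> 0" for r t
      using that by (simp add: field_simps power2_eq_square)
    ultimately show ?thesis using q0 q1 by (simp add: v(3) y_def)
  qed
  finally have slope: "u * slope_M D \<rho> \<rho>f =
      2 * q - 2 * y + v\<^sup>2 * (2 * q\<^sup>2 / (1 + q)\<^sup>2 - y / (1 + q)) - (1 + (1 - v)\<^sup>2) * b" .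
  \<comment> \<open>\<open>E0\<close> and \<open>E1\<close> are the values at \<open>v = 0\<close>
    and \<open>v = 1\<close> of the surplus divided by \<open>v\<close>, which is affine in
    \<open>v\<close>.\<close>
  have E0: "0 \<le> 2 * q\<^sup>2 - y * (1 + q)"
  proof -
    have "y * (1 + q) \<le> q\<^sup>2 / 4 * (1 + q)" using y q0 by (intro mult_right_mono) auto
    also have "\<dots> \<le> q\<^sup>2 / 4 * 2" using q1 by (intro mult_left_mono) auto
    finally show ?thesis using zero_le_power2[of q] by linarith
  qed
  have E1: "0 \<le> q ^ 3 + 2 * q\<^sup>2 / (1 + q)\<^sup>2 - y * (q + 1 / (1 + q))"
  proof -
    have "y * (q + 1 / (1 + q)) \<le> q\<^sup>2 / 4 * (q + 1 / (1 + q))" using y q0 by (intro mult_right_mono) auto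
    moreover have "q ^ 3 + 2 * q\<^sup>2 / t\<^sup>2 - q\<^sup>2 / 4 * (q + 1 / t) =
        q\<^sup>2 * (3 / 4 * q + (8 - t) / (4 * t\<^sup>2))" if "t \<noteq> 0" for t
      using that by (simp add: field_simps power2_eq_square power3_eq_cube)
    from this[of "1 + q"] have "q ^ 3 + 2 * q\<^sup>2 / (1 + q)\<^sup>2 - q\<^sup>2 / 4 * (q + 1 / (1 + q)) =
        q\<^sup>2 * (3 / 4 * q + (8 - (1 + q)) / (4 * (1 + q)\<^sup>2))" using q0 by simp
    moreover have "0 \<le> q\<^sup>2 * (3 / 4 * q + (8 - (1 + q)) / (4 * (1 + q)\<^sup>2))"
      using q0 q1 by (intro mult_nonneg_nonneg add_nonneg_nonneg divide_nonneg_nonneg) auto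
    ultimately show ?thesis by linarith
  qed
  have "u * slope_M D \<rho> \<rho>f - (b - (1 - u) * (b - u * q)) =
      v * ((1 - v) * (2 * q\<^sup>2 - y * (1 + q)) + v * (q ^ 3 + 2 * q\<^sup>2 / (1 + q)\<^sup>2 - y * (q + 1 / (1 + q))))"
  proof -
    \<comment> \<open>With the fractions replaced by free \<open>A\<close> and \<open>B\<close> this
      is a polynomial identity.\<close>
    have "2 * q - 2 * y + v\<^sup>2 * (2 * A - y * B) - (1 + (1 - v)\<^sup>2) * (q - y) -
        ((q - y) - (1 - v * (1 - q)) * ((q - y) - v * (1 - q) * q)) =
        v * ((1 - v) * (2 * q\<^sup>2 - y * (1 + q)) + v * (q ^ 3 + 2 * A - y * (q + B)))" for A B
      by (simp add: algebra_simps power2_eq_square power3_eq_cube)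
    from this[of "q\<^sup>2 / (1 + q)\<^sup>2" "1 / (1 + q)"] show ?thesis
      unfolding slope b_def by (simp add: v(3))
  qed
  also have "\<dots> \<ge> 0"
    using v E0 E1 by (intro mult_nonneg_nonneg add_nonneg_nonneg) auto
  finally have "b - (1 - u) * (b - u * q) \<le> u * slope_M D \<rho> \<rho>f" by simp
  then have "l * (b - (1 - u) * (b - u * q)) \<le> l * (u * slope_M D \<rho> \<rho>f)"
    using l by (rule mult_left_mono)
  then show ?thesis unfolding bound share by (simp add: mult_ac)
qed


section \<open>Achievability of the region\<close>

text \<open>Achievability asks for equality with the upper limits, so rates are used that eventually
  equal a multiple of \<open>1 / 2 * log 2 P\<close>.\<close>

lemma MG_limsup_eventually:
  assumes "\<forall>\<^sub>F K in sequentially. \<forall>\<^sub>F P in at_top. R K P = s * (1 / 2 * log 2 P)"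
  shows "MG_limsup R = ereal s"
proof -
  have "\<forall>\<^sub>F K in sequentially. Limsup at_top (\<lambda>P. ereal (R K P / (1 / 2 * log 2 P))) = ereal s"
    using assms
  proof eventually_elim
    case (elim K)
    have "\<forall>\<^sub>F P in at_top. ereal (R K P / (1 / 2 * log 2 P)) = ereal s"
      using elim eventually_gt_at_top[of 1]
    proof eventually_elim
      case (elim P)
      then have "0 < log 2 P" by simp
      then have "log 2 P \<noteq> 0" by linarith
      with elim show ?case by simp
    qed
    then have "Limsup at_top (\<lambda>P. ereal (R K P / (1 / 2 * log 2 P))) = Limsup at_top (\<lambda>P :: real. ereal s)"
      by (rule Limsup_eq)
    then show ?case by (simp add: Limsup_const)
  qed
  then have "MG_limsup R = Limsup sequentially (\<lambda>K. ereal s)"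
    unfolding MG_limsup_def by (rule Limsup_eq)
  then show ?thesis by (simp add: Limsup_const)
qed

text \<open>Because of \<open>s < a\<close>, the growth of the second term of the minimum eventually
  outruns the constants \<open>C\<close> and 1.\<close>

lemma eventually_rate_eq:
  fixes s a C :: real
  assumes "0 \<le> s" and "s = 0 \<or> s < a"
  shows "\<forall>\<^sub>F P in at_top. max 0 (min (s * (1 / 2 * log 2 P)) (a * max 0 (1 / 2 * log 2 P - C) - 1)) =
    s * (1 / 2 * log 2 P)"
proof (cases "s = 0")
  case False
  then have sa: "0 < s" "s < a" using assms by auto
  \<comment> \<open>The last term solves \<open>s * p \<le> a * (p - C) - 1\<close> for
    \<open>p\<close>.\<close>
  define M where "M = max (max 0 C) ((a * C + 1) / (a - s))"
  show ?thesis
    using eventually_ge_at_top[of "2 powr (2 * M)"]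
  proof eventually_elim
    case (elim P)
    have "0 < P" using elim by (smt (verit) powr_gt_zero)
    define p where "p = 1 / 2 * log 2 P"
    have "2 * M \<le> log 2 P" using elim \<open>0 < P\<close> by (simp add: le_log_iff)
    then have "M \<le> p" by (simp add: p_def)
    moreover have "0 \<le> M" "C \<le> M" "(a * C + 1) / (a - s) \<le> M" by (simp_all add: M_def)
    ultimately have "0 \<le> p" "C \<le> p" "(a * C + 1) / (a - s) \<le> p" by linarith+
    then have "a * C + 1 \<le> p * (a - s)" using sa by (simp add: divide_le_eq)
    then have "s * p \<le> a * (p - C) - 1" by (simp add: algebra_simps)
    then show ?case using \<open>C \<le> p\<close> \<open>0 \<le> p\<close> sa unfolding p_def[symmetric] by (simp add: min_def max_def)
  qed
qed simp

text \<open>Strict inequalities leave room for the loss of order \<delta>. A zero component needs no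
  room, since rate 0 can always be used.\<close>

lemma achievable_MG_interior:
  fixes \<rho> \<rho>f l s e :: real and D :: nat
  assumes ns: "nonsingular_runs h (D + 1)"
    and \<rho>: "0 < \<rho>" "\<rho> < 1" and \<rho>f: "0 \<le> \<rho>f" "\<rho>f \<le> 1" and l: "l \<le> 1 / 2"
    and s: "0 \<le> s" "s < l \<or> s = 0 \<and> l = 0"
    and e: "0 \<le> e" "e = 0 \<or> e < MG_share l (D + 2) (\<rho> * (1 - \<rho>f)) (\<rho> * \<rho>f)"
  shows "achievable_MG h D \<rho> \<rho>f (\<rho> * \<rho>f * s, e)"
proof -
  define w where "w = MG_share l (D + 2) (\<rho> * (1 - \<rho>f)) (\<rho> * \<rho>f)"
  define W where "W = (\<lambda>K. measure_pmf.expectation (activity_pmf \<rho> \<rho>f K)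
      (\<lambda>ab. 1 / real K * (\<Sum>k\<in>K_eMBB K ab. share l D K ab k)))"
  \<comment> \<open>A quarter of the available slack, because \<open>3 * \<delta>\<close> is
    lost.\<close>
  define \<delta> where "\<delta> = min (if s = 0 then 1 else (l - s) / 4) (if e = 0 then 1 else (w - e) / 4)"
  have \<delta>: "0 < \<delta>" using s e by (auto simp: \<delta>_def w_def)
  have l0: "0 \<le> l" using s by auto
  have sl: "s = 0 \<or> s < l - 3 * \<delta>" using s by (auto simp: \<delta>_def min_def field_simps)
  have ew: "e = 0 \<or> e < w - 3 * \<delta>" using e by (auto simp: \<delta>_def w_def min_def field_simps)
  have q: "\<rho> * (1 - \<rho>f) < 1" using \<rho> \<rho>f mult_left_le[of "1 - \<rho>f" \<rho>] by linarith
  have int: "integrable (measure_pmf (activity_pmf \<rho> \<rho>f K)) g" for K and g :: "activity \<Rightarrow> real"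
    using \<rho> \<rho>f by (intro integrable_measure_pmf_finite finite_set_activity_pmf) auto
  have "\<forall>K. \<exists>C. 1 \<le> K \<longrightarrow> (\<forall>P RU Rbar L. 0 < P \<longrightarrow> L = max 0 (1 / 2 * log 2 P - C) \<longrightarrow>
    0 \<le> RU \<longrightarrow> RU \<le> max 0 ((l - 3 * \<delta>) * L - 1) \<longrightarrow> 0 \<le> Rbar \<longrightarrow>
    Rbar \<le> measure_pmf.expectation (activity_pmf \<rho> \<rho>f K)
      (\<lambda>ab. 1 / real K * (\<Sum>k\<in>K_eMBB K ab. max 0 ((share l D K ab k - 3 * \<delta>) * L - 1))) \<longrightarrow>
    achievable_rates h D \<rho> \<rho>f P K RU Rbar)"
  proof
    fix K
    show "\<exists>C. 1 \<le> K \<longrightarrow> (\<forall>P RU Rbar L. 0 < P \<longrightarrow> L = max 0 (1 / 2 * log 2 P - C) \<longrightarrow>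
      0 \<le> RU \<longrightarrow> RU \<le> max 0 ((l - 3 * \<delta>) * L - 1) \<longrightarrow> 0 \<le> Rbar \<longrightarrow>
      Rbar \<le> measure_pmf.expectation (activity_pmf \<rho> \<rho>f K)
        (\<lambda>ab. 1 / real K * (\<Sum>k\<in>K_eMBB K ab. max 0 ((share l D K ab k - 3 * \<delta>) * L - 1))) \<longrightarrow>
      achievable_rates h D \<rho> \<rho>f P K RU Rbar)"
    proof (cases "1 \<le> K")
      case True
      show ?thesis by (rule achievable_pair[OF ns l0 l \<delta> True, of \<rho> \<rho>f]) blast
    qed simp
  qed
  then obtain C where C: "\<And>K P RU Rbar L. 1 \<le> K \<Longrightarrow> 0 < P \<Longrightarrow> L = max 0 (1 / 2 * log 2 P - C K) \<Longrightarrow>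
    0 \<le> RU \<Longrightarrow> RU \<le> max 0 ((l - 3 * \<delta>) * L - 1) \<Longrightarrow> 0 \<le> Rbar \<Longrightarrow>
    Rbar \<le> measure_pmf.expectation (activity_pmf \<rho> \<rho>f K)
      (\<lambda>ab. 1 / real K * (\<Sum>k\<in>K_eMBB K ab. max 0 ((share l D K ab k - 3 * \<delta>) * L - 1))) \<Longrightarrow>
    achievable_rates h D \<rho> \<rho>f P K RU Rbar"
    unfolding choice_iff by blast
  define L where "L = (\<lambda>K P. max 0 (1 / 2 * log 2 P - C K))"
  \<comment> \<open>Capped by the target, so that the limits are exact, and cut off at 0, since
    rates must be nonnegative for every \<open>P > 0\<close>.\<close>
  define RU where "RU = (\<lambda>K P. max 0 (min (s * (1 / 2 * log 2 P)) ((l - 3 * \<delta>) * L K P - 1)))"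
  define Rbar where "Rbar = (\<lambda>K P. max 0 (min (e * (1 / 2 * log 2 P)) ((W K - 3 * \<delta>) * L K P - 1)))"
  have rates: "achievable_rates h D \<rho> \<rho>f P K (RU K P) (Rbar K P)" if K: "1 \<le> K" and P: "0 < P" for K P
  proof (rule C[OF K P])
    show "L K P = max 0 (1 / 2 * log 2 P - C K)" by (simp add: L_def)
    let ?E = "measure_pmf.expectation (activity_pmf \<rho> \<rho>f K)"
    let ?R = "\<lambda>ab. 1 / real K * (\<Sum>k\<in>K_eMBB K ab. max 0 ((share l D K ab k - 3 * \<delta>) * L K P - 1))"
    have L0: "0 \<le> L K P" by (simp add: L_def)
    \<comment> \<open>Replacing \<open>max 0 x\<close> by \<open>x\<close> makes the bound affine in
      the shares. As there are at most \<open>K\<close> eMBB users, the expected rate is then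
      controlled by the mean share \<open>W K\<close>.\<close>
    have "L K P * (1 / real K * (\<Sum>k\<in>K_eMBB K ab. share l D K ab k)) - (3 * \<delta> * L K P + 1) \<le> ?R ab" for ab
    proof -
      have "card (K_eMBB K ab) \<le> card {1..K}"
        by (intro card_mono) (auto simp: K_eMBB_def K_active_def)
      then have "real (card (K_eMBB K ab)) * (3 * \<delta> * L K P + 1) \<le> K * (3 * \<delta> * L K P + 1)"
        using \<delta> L0 by (intro mult_right_mono) auto
      then have "L K P * (\<Sum>k\<in>K_eMBB K ab. share l D K ab k) - K * (3 * \<delta> * L K P + 1) \<le>
          (\<Sum>k\<in>K_eMBB K ab. (share l D K ab k - 3 * \<delta>) * L K P - 1)"
      proof -
        have "(share l D K ab k - 3 * \<delta>) * L K P - 1 = L K P * share l D K ab k - (3 * \<delta> * L K P + 1)" for k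
          by (simp add: algebra_simps)
        then have "(\<Sum>k\<in>K_eMBB K ab. (share l D K ab k - 3 * \<delta>) * L K P - 1) =
            L K P * (\<Sum>k\<in>K_eMBB K ab. share l D K ab k) - real (card (K_eMBB K ab)) * (3 * \<delta> * L K P + 1)"
          by (simp only: sum_subtractf sum_distrib_left[symmetric] sum_constant)
        then show ?thesis using \<open>real (card _) * _ \<le> _\<close> by linarith
      qed
      also have "\<dots> \<le> (\<Sum>k\<in>K_eMBB K ab. max 0 ((share l D K ab k - 3 * \<delta>) * L K P - 1))"
        by (intro sum_mono) simp
      finally have "1 / real K * (L K P * (\<Sum>k\<in>K_eMBB K ab. share l D K ab k) - K * (3 * \<delta> * L K P + 1)) \<le> ?R ab"
        by (intro mult_left_mono) auto
      then show ?thesis using K by (simp add: diff_divide_distrib mult.commute)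
    qed
    then have "?E (\<lambda>ab. L K P * (1 / real K * (\<Sum>k\<in>K_eMBB K ab. share l D K ab k)) - (3 * \<delta> * L K P + 1)) \<le> ?E ?R"
      by (intro integral_mono int)
    also have "?E (\<lambda>ab. L K P * (1 / real K * (\<Sum>k\<in>K_eMBB K ab. share l D K ab k)) - (3 * \<delta> * L K P + 1)) =
        L K P * W K - (3 * \<delta> * L K P + 1)"
      by (simp only: Bochner_Integration.integral_diff int integral_mult_right_zero W_def) simp
    finally have "(W K - 3 * \<delta>) * L K P - 1 \<le> ?E ?R" by (simp add: algebra_simps)
    moreover have "0 \<le> ?E ?R"
      by (intro integral_nonneg_AE AE_I2) (simp add: sum_nonneg)
    ultimately show "Rbar K P \<le> ?E ?R" by (simp add: Rbar_def min_le_iff_disj)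
  qed (auto simp: RU_def Rbar_def)
  have "MG_limsup RU = ereal s"
    unfolding RU_def L_def by (intro MG_limsup_eventually always_eventually allI eventually_rate_eq s sl)
  moreover have "MG_limsup Rbar = ereal e"
  proof (rule MG_limsup_eventually)
    have "\<forall>\<^sub>F K in sequentially. e = 0 \<or> e < W K - 3 * \<delta>"
    proof (cases "e = 0")
      case False
      define c where "c = 1 / (1 - \<rho> * (1 - \<rho>f))"
      have "(\<lambda>K. w - (2 * w + c) * (1 / real K) - 3 * \<delta>) \<longlonglongrightarrow> w - (2 * w + c) * 0 - 3 * \<delta>"
        by (intro tendsto_intros lim_1_over_n)
      then have "\<forall>\<^sub>F K in sequentially. e < w - (2 * w + c) * (1 / real K) - 3 * \<delta>"
        using ew False by (intro order_tendstoD) auto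
      then show ?thesis using eventually_ge_at_top[of 2]
      proof eventually_elim
        case (elim K)
        have "w * (real K - 2) / real K - c / real K \<le> W K"
          unfolding w_def c_def W_def using \<rho> \<rho>f q l0 l elim by (intro expected_share) auto
        moreover have "w * (real K - 2) / real K - c / real K = w - (2 * w + c) * (1 / real K)"
          using elim by (simp add: field_simps)
        ultimately show ?case using elim by linarith
      qed
    qed simp
    then show "\<forall>\<^sub>F K in sequentially. \<forall>\<^sub>F P in at_top. Rbar K P = e * (1 / 2 * log 2 P)"
    proof eventually_elim
      case (elim K)
      then show ?case unfolding Rbar_def L_def by (intro eventually_rate_eq e)
    qed
  qed
  ultimately show ?thesis
    unfolding achievable_MG_def using rates by (intro exI[of _ RU] exI[of _ Rbar]) auto
qed

theorem theorem7:
  fixes h :: "nat \<Rightarrow> nat \<Rightarrow> real" and D :: nat and \<rho> \<rho>f :: real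
  assumes "D > 0" and "even D"
    and "\<And>j k. h j k \<ge> 0" and "nonsingular_runs h (D + 1)"
    and "0 < \<rho>" and "\<rho> < 1" and "0 \<le> \<rho>f" and "\<rho>f \<le> 1"
  shows "{(SU, Se). 0 \<le> SU \<and> 0 \<le> Se \<and> SU \<le> \<rho> * \<rho>f / 2 \<and>
           (if \<rho>f = 0 then Se else Se + slope_M D \<rho> \<rho>f * SU) \<le> eMBB_bound D \<rho> \<rho>f}
         \<subseteq> MG_region h D \<rho> \<rho>f"
proof clarify
  fix SU Se
  assume SU: "0 \<le> SU" "SU \<le> \<rho> * \<rho>f / 2" and Se: "0 \<le> Se"
    and le: "(if \<rho>f = 0 then Se else Se + slope_M D \<rho> \<rho>f * SU) \<le> eMBB_bound D \<rho> \<rho>f"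
  let ?u = "\<rho> * \<rho>f"
  let ?w = "\<lambda>l. MG_share l (D + 2) (\<rho> * (1 - \<rho>f)) ?u"
  \<comment> \<open>For \<open>\<rho>f = 0\<close> there is no URLLC traffic, \<open>SU = 0\<close>,
    and phase 0 takes all the time.\<close>
  obtain l where l: "0 \<le> l" "l \<le> 1 / 2" "SU = ?u * l" and w: "Se \<le> ?w l"
  proof (cases "\<rho>f = 0")
    case True
    then have "Se \<le> ?w 0" using le by (simp add: MG_share_def eMBB_bound_eq)
    then show thesis using that[of 0] SU True by simp
  next
    case False
    then have u: "0 < ?u" and "0 < \<rho>f" using assms by auto
    have "2 \<le> D" using assms by presburger
    define l where "l = SU / ?u"
    have l: "0 \<le> l" "l \<le> 1 / 2" "SU = ?u * l" using u SU by (auto simp: l_def field_simps)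
    have "Se \<le> eMBB_bound D \<rho> \<rho>f - slope_M D \<rho> \<rho>f * (?u * l)" using le False l by simp
    also have "\<dots> \<le> ?w l"
      using \<open>2 \<le> D\<close> \<open>0 < \<rho>f\<close> l assms by (intro eMBB_bound_le_MG_share) auto
    finally show thesis using that l by blast
  qed
  \<comment> \<open>Scaling by a factor below 1, with \<open>l\<close> kept fixed, gives the strict
    inequalities of \<open>achievable_MG_interior\<close>; the closure recovers the pair
    itself.\<close>
  define \<eta> where "\<eta> = (\<lambda>i. 1 - inverse (real (Suc i)))"
  have "(SU * \<eta> i, Se * \<eta> i) \<in> {S. achievable_MG h D \<rho> \<rho>f S}" for i
  proof -
    have \<eta>: "0 \<le> \<eta> i" "\<eta> i < 1" by (simp_all add: \<eta>_def inverse_le_1_iff)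
    have "l * \<eta> i < l \<or> l * \<eta> i = 0 \<and> l = 0" using l \<eta> by (cases "l = 0") auto
    moreover have "Se * \<eta> i = 0 \<or> Se * \<eta> i < ?w l"
    proof (cases "Se = 0")
      case False
      then have "Se * \<eta> i < Se" using Se \<eta> by simp
      then show ?thesis using w by simp
    qed simp
    ultimately have "achievable_MG h D \<rho> \<rho>f (?u * (l * \<eta> i), Se * \<eta> i)"
      using assms l Se \<eta> by (intro achievable_MG_interior[where l = l]) auto
    then show ?thesis by (simp add: l(3) mult.assoc)
  qed
  moreover have "(\<lambda>i. (SU * \<eta> i, Se * \<eta> i)) \<longlonglongrightarrow> (SU, Se)"
  proof -
    have "\<eta> \<longlonglongrightarrow> 1 - 0"
      unfolding \<eta>_def by (intro tendsto_diff tendsto_const LIMSEQ_inverse_real_of_nat)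
    then have "(\<lambda>i. (SU * \<eta> i, Se * \<eta> i)) \<longlonglongrightarrow> (SU * (1 - 0), Se * (1 - 0))"
      by (intro tendsto_Pair tendsto_mult tendsto_const)
    then show ?thesis by simp
  qed
  ultimately show "(SU, Se) \<in> MG_region h D \<rho> \<rho>f"
    unfolding MG_region_def closure_sequential by (intro exI[of _ "\<lambda>i. (SU * \<eta> i, Se * \<eta> i)"]) blast
qed

end
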